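(* For every chain graph $G=(V,E)$, the discrete chain graph model $\mathbf{P}_{\mathrm{IV}}(G)$ is a curved exponential family.
   Context: Graphs. $G=(V,E)$ has finite vertex set $V$ and $E\subseteq(V\times V)\setminus\{(v,v):v\in V\}$. An edge $(v,w)\in E$ is undirected ($v-w$) if $(w,v)\in E$, and directed ($v\to w$) otherwise. If $v\to w$, $v$ is a parent of $w$; if $v-w$, $v$ is a neighbor of $w$; $\mathrm{pa}_G(v)$ and $\mathrm{nb}_G(v)$ are the sets of parents and neighbors of $v$. For $\sigma\subseteq V$, $\mathrm{pa}_G(\sigma)=(\bigcup_{v\in\sigma}\mathrm{pa}_G(v))\setminus\sigma$, $\mathrm{nb}_G(\sigma)=(\bigcup_{v\in\sigma}\mathrm{nb}_G(v))\setminus\sigma$, $\mathrm{Nb}_G(\sigma)=\mathrm{nb}_G(\sigma)\cup\sigma$. A semi-directed cycle is a sequence of distinct vertices $v_0,\dots,v_k$ with $(v_i,v_{i+1})\in E$ for $0\le i\le k$ (where $v_{k+1}=v_0$), at least one of these edges being directed. A chain graph is a graph without semi-directed cycles. Its chain components are the equivalence classes of vertices under the relation "joined by a path of undirected edges"; $\mathscr{T}$ is the set of chain components. $D=D(G)$ is the acyclic digraph with vertex set $\mathscr{T}$ and an edge $\tau_1\to\tau_2$ iff $v\to w$ in $G$ for some $v\in\tau_1,w\in\tau_2$. For $\tau\in\mathscr{T}$, $\mathrm{pa}_D(\tau)\subseteq V$ is the union of all parents of $\tau$ in $D$, and $\mathrm{nd}_D(\tau)\subseteq V$ is the union of all $\bar\tau\in\mathscr{T}\setminus\{\tau\}$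 such that there is no directed path from $\tau$ to $\bar\tau$ in $D$. Model. $X=(X_v\mid v\in V)$ is a random vector with $X_v$ taking values in $[d_v]=\{1,\dots,d_v\}$; $\mathcal{I}=\prod_{v\in V}[d_v]$. Joint distributions are identified with vectors $p=(p(i)\mid i\in\mathcal{I})$, $p(i)=P(X=i)$, in the probability simplex $\Delta$; its interior $\Delta^o$ (all $p(i)>0$) corresponds to the regular exponential family of positive distributions on $\mathcal{I}$. For disjoint $\alpha,\beta,\gamma\subseteq V$, $\alpha\perp\!\!\!\perp\beta\mid\gamma$ means that $X_\alpha$ and $X_\beta$ are conditionally independent given $X_\gamma$ (marginally independent if $\gamma=\varnothing$; void if $\alpha$ or $\beta$ is empty). The model $\mathbf{P}_{\mathrm{IV}}(G)$ is the set of $p\in\Delta^o$ obeying the block-recursive Markov property of type IV: for all $\tau\in\mathscr{T}$ and all $\sigma\subseteq\tau$, (C1) $\tau\perp\!\!\!\perp[\mathrm{nd}_D(\tau)\setminus\mathrm{pa}_D(\tau)]\mid\mathrm{pa}_D(\tau)$; (C2b) $\sigma\perp\!\!\!\perp[\tau\setminus\mathrm{Nb}_G(\sigma)]\mid\mathrm{pa}_D(\tau)$; (C3b) $\sigma\perp\!\!\!\perp[\mathrm{pa}_D(\tau)\setminus\mathrm{pa}_G(\sigma)]\mid\mathrm{pa}_G(\sigma)$. Curved exponential family. A subfamily of a regular exponential family is a curved exponential family if it corresponds to a smooth (embedded) submanifold of the natural parameter space; for the family of positive distributions on $\mathcal{I}$ this is equivalent to the set of probability vectors being a smooth embedded submanifold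 of $\Delta^o$. *)

theory Defs
  imports "HOL-Probability.Probability"
begin

section \<open>Chain graphs\<close>

definition directed :: "('v \<times> 'v) set \<Rightarrow> 'v \<Rightarrow> 'v \<Rightarrow> bool" where
  "directed E v w \<longleftrightarrow> (v, w) \<in> E \<and> (w, v) \<notin> E"

definition undirected :: "('v \<times> 'v) set \<Rightarrow> 'v \<Rightarrow> 'v \<Rightarrow> bool" where
  "undirected E v w \<longleftrightarrow> (v, w) \<in> E \<and> (w, v) \<in> E"

definition parents :: "('v \<times> 'v) set \<Rightarrow> 'v set \<Rightarrow> 'v set" where
  "parents E \<sigma> = (\<Union>v\<in>\<sigma>. {w. directed E w v}) - \<sigma>"

definition neighbors :: "('v \<times> 'v) set \<Rightarrow> 'v set \<Rightarrow> 'v set" where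
  "neighbors E \<sigma> = (\<Union>v\<in>\<sigma>. {w. undirected E w v}) - \<sigma>"

definition closed_neighbors :: "('v \<times> 'v) set \<Rightarrow> 'v set \<Rightarrow> 'v set" where
  "closed_neighbors E \<sigma> = neighbors E \<sigma> \<union> \<sigma>"

definition semi_directed_cycle :: "('v \<times> 'v) set \<Rightarrow> 'v list \<Rightarrow> bool" where
  "semi_directed_cycle E vs \<longleftrightarrow> vs \<noteq> [] \<and> distinct vs \<and>
     (\<forall>i<length vs. (vs ! i, vs ! (Suc i mod length vs)) \<in> E) \<and>
     (\<exists>i<length vs. directed E (vs ! i) (vs ! (Suc i mod length vs)))"

definition chain_graph :: "'v set \<Rightarrow> ('v \<times> 'v) set \<Rightarrow> bool" where
  "chain_graph V E \<longleftrightarrow> finite V \<and> E \<subseteq> V \<times> V \<and> (\<forall>v. (v, v) \<notin> E) \<and>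
     (\<forall>vs. \<not> semi_directed_cycle E vs)"

definition chain_components :: "'v set \<Rightarrow> ('v \<times> 'v) set \<Rightarrow> 'v set set" where
  "chain_components V E = V // {(v, w) \<in> V \<times> V. (undirected E)\<^sup>*\<^sup>* v w}"

definition component_dag :: "'v set \<Rightarrow> ('v \<times> 'v) set \<Rightarrow> ('v set \<times> 'v set) set" where
  "component_dag V E = {(\<tau>1, \<tau>2) \<in> chain_components V E \<times> chain_components V E.
     \<exists>v\<in>\<tau>1. \<exists>w\<in>\<tau>2. directed E v w}"

definition parents_D :: "'v set \<Rightarrow> ('v \<times> 'v) set \<Rightarrow> 'v set \<Rightarrow> 'v set" where
  "parents_D V E \<tau> = \<Union>{\<tau>'. (\<tau>', \<tau>) \<in> component_dag V E}"

definition nondescendants_D :: "'v set \<Rightarrow> ('v \<times> 'v) set \<Rightarrow> 'v set \<Rightarrow> 'v set" where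
  "nondescendants_D V E \<tau> =
     \<Union>{\<tau>' \<in> chain_components V E - {\<tau>}. (\<tau>, \<tau>') \<notin> (component_dag V E)\<^sup>+}"


section \<open>The discrete chain graph model of type IV\<close>

text \<open>
  The state space of the vertex \<open>v\<close> is \<open>{1..d v}\<close>. Vectors indexed by a finite set \<open>J\<close> are
  functions in \<open>J \<rightarrow>\<^sub>E UNIV\<close>, that is, they are \<open>undefined\<close> outside \<open>J\<close>.
\<close>

definition configs :: "'v set \<Rightarrow> ('v \<Rightarrow> nat) \<Rightarrow> ('v \<Rightarrow> nat) set" where
  "configs V d = (\<Pi>\<^sub>E v\<in>V. {1..d v})"

definition open_simplex :: "'x set \<Rightarrow> ('x \<Rightarrow> real) set" where
  "open_simplex I = {p \<in> I \<rightarrow>\<^sub>E UNIV. (\<forall>i\<in>I. 0 < p i) \<and> (\<Sum>i\<in>I. p i) = 1}"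

text \<open>
  The sample space is \<open>I\<close>, with point masses \<open>p\<close>; the random vector \<open>X\<close> is the identity, and
  its subvector indexed by \<open>\<alpha>\<close> is \<open>\<lambda>x. restrict x \<alpha>\<close>. The values of \<open>X\<close> on
  \<open>\<alpha>\<close>, \<open>\<beta>\<close> and \<open>\<gamma>\<close> are given by the corresponding parts of \<open>a\<close>, \<open>b\<close> and \<open>c\<close>.
  For positive \<open>p\<close> the conditioning events have positive probability; the condition is
  marginal independence if \<open>\<gamma> = {}\<close>, and it is void if \<open>\<alpha> = {}\<close> or \<open>\<beta> = {}\<close>.
\<close>

definition cond_indep ::
  "('v \<Rightarrow> nat) set \<Rightarrow> (('v \<Rightarrow> nat) \<Rightarrow> real) \<Rightarrow> 'v set \<Rightarrow> 'v set \<Rightarrow> 'v set \<Rightarrow> bool" where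
  "cond_indep I p \<alpha> \<beta> \<gamma> \<longleftrightarrow> (\<forall>a\<in>I. \<forall>b\<in>I. \<forall>c\<in>I.
     cond_prob (point_measure I (\<lambda>x. ennreal (p x)))
       (\<lambda>x. restrict x \<alpha> = restrict a \<alpha> \<and> restrict x \<beta> = restrict b \<beta>)
       (\<lambda>x. restrict x \<gamma> = restrict c \<gamma>) =
     cond_prob (point_measure I (\<lambda>x. ennreal (p x)))
       (\<lambda>x. restrict x \<alpha> = restrict a \<alpha>) (\<lambda>x. restrict x \<gamma> = restrict c \<gamma>) *
     cond_prob (point_measure I (\<lambda>x. ennreal (p x)))
       (\<lambda>x. restrict x \<beta> = restrict b \<beta>) (\<lambda>x. restrict x \<gamma> = restrict c \<gamma>))"

definition markov_IV ::
  "'v set \<Rightarrow> ('v \<times> 'v) set \<Rightarrow> ('v \<Rightarrow> nat) set \<Rightarrow> (('v \<Rightarrow> nat) \<Rightarrow> real) \<Rightarrow> bool" where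
  "markov_IV V E I p \<longleftrightarrow> (\<forall>\<tau>\<in>chain_components V E.
     cond_indep I p \<tau> (nondescendants_D V E \<tau> - parents_D V E \<tau>) (parents_D V E \<tau>) \<and>
     (\<forall>\<sigma>\<subseteq>\<tau>.
        cond_indep I p \<sigma> (\<tau> - closed_neighbors E \<sigma>) (parents_D V E \<tau>) \<and>
        cond_indep I p \<sigma> (parents_D V E \<tau> - parents E \<sigma>) (parents E \<sigma>)))"

definition P_IV ::
  "'v set \<Rightarrow> ('v \<times> 'v) set \<Rightarrow> ('v \<Rightarrow> nat) \<Rightarrow> (('v \<Rightarrow> nat) \<Rightarrow> real) set" where
  "P_IV V E d = {p \<in> open_simplex (configs V d). markov_IV V E (configs V d) p}"


section \<open>Smooth embedded submanifolds of coordinate space\<close>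

text \<open>
  For finite \<open>J\<close> the topological space \<open>powertop_real J\<close>, with underlying set
  \<open>J \<rightarrow>\<^sub>E UNIV\<close>, is the Euclidean space with coordinates indexed by \<open>J\<close>.
  A function on an open set \<open>U\<close> is smooth if its iterated partial derivatives of all orders
  exist and are continuous on \<open>U\<close>: it is continuous, and its first partial derivatives exist
  and are themselves smooth. This is a greatest fixed point.
\<close>

coinductive smooth_on :: "'j set \<Rightarrow> ('j \<Rightarrow> real) set \<Rightarrow> (('j \<Rightarrow> real) \<Rightarrow> real) \<Rightarrow> bool"
  for J U where
  "continuous_map (subtopology (powertop_real J) U) euclideanreal f \<Longrightarrow>
   \<forall>j\<in>J. \<exists>g. smooth_on J U g \<and>
     (\<forall>x\<in>U. ((\<lambda>t. f (x(j := t))) has_real_derivative g x) (at (x j))) \<Longrightarrow>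
   smooth_on J U f"

definition diffeomorphism ::
  "'j set \<Rightarrow> ('j \<Rightarrow> real) set \<Rightarrow> ('j \<Rightarrow> real) set \<Rightarrow>
   (('j \<Rightarrow> real) \<Rightarrow> ('j \<Rightarrow> real)) \<Rightarrow> (('j \<Rightarrow> real) \<Rightarrow> ('j \<Rightarrow> real)) \<Rightarrow> bool" where
  "diffeomorphism J U W \<phi> \<psi> \<longleftrightarrow>
     openin (powertop_real J) U \<and> openin (powertop_real J) W \<and>
     \<phi> \<in> U \<rightarrow> W \<and> \<psi> \<in> W \<rightarrow> U \<and> (\<forall>x\<in>U. \<psi> (\<phi> x) = x) \<and> (\<forall>y\<in>W. \<phi> (\<psi> y) = y) \<and>
     (\<forall>j\<in>J. smooth_on J U (\<lambda>x. \<phi> x j)) \<and> (\<forall>j\<in>J. smooth_on J W (\<lambda>y. \<psi> y j))"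

text \<open>
  Every point of \<open>M\<close> lies in the domain of a slice chart. Since the charts may permute the
  coordinates, fixing the set \<open>K\<close> amounts to fixing the dimension of \<open>M\<close>, which is \<open>card K\<close>.
\<close>

definition embedded_submanifold :: "'j set \<Rightarrow> ('j \<Rightarrow> real) set \<Rightarrow> bool" where
  "embedded_submanifold J M \<longleftrightarrow> finite J \<and> M \<subseteq> (J \<rightarrow>\<^sub>E UNIV) \<and>
     (\<exists>K\<subseteq>J. \<forall>x\<in>M. \<exists>U W \<phi> \<psi>. x \<in> U \<and> diffeomorphism J U W \<phi> \<psi> \<and>
        \<phi> ` (M \<inter> U) = {y \<in> W. \<forall>j\<in>J - K. y j = 0})"


section \<open>Curved exponential families on a finite sample space\<close>

text \<open>
  The exponential family on the finite set \<open>I\<close> with sufficient statistics \<open>T j\<close> for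
  \<open>j \<in> J\<close>. Its natural parameter space is the whole of \<open>J \<rightarrow>\<^sub>E UNIV\<close>, so it is regular.
  Injectivity of \<open>exp_family I J T\<close> says that the parameters are identifiable (a minimal
  representation), so that subfamilies correspond to subsets of the parameter space.
\<close>

definition exp_family ::
  "'x set \<Rightarrow> 'j set \<Rightarrow> ('j \<Rightarrow> 'x \<Rightarrow> real) \<Rightarrow> ('j \<Rightarrow> real) \<Rightarrow> 'x \<Rightarrow> real" where
  "exp_family I J T \<theta> = (\<lambda>x\<in>I. exp (\<Sum>j\<in>J. \<theta> j * T j x) / (\<Sum>y\<in>I. exp (\<Sum>j\<in>J. \<theta> j * T j y)))"

definition curved_exp_family ::
  "'x set \<Rightarrow> 'j set \<Rightarrow> ('j \<Rightarrow> 'x \<Rightarrow> real) \<Rightarrow> ('x \<Rightarrow> real) set \<Rightarrow> bool" where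
  "curved_exp_family I J T M \<longleftrightarrow> finite I \<and>
     inj_on (exp_family I J T) (J \<rightarrow>\<^sub>E UNIV) \<and>
     M \<subseteq> exp_family I J T ` (J \<rightarrow>\<^sub>E UNIV) \<and>
     embedded_submanifold J {\<theta> \<in> J \<rightarrow>\<^sub>E UNIV. exp_family I J T \<theta> \<in> M}"

text \<open>
  The positive distributions on \<open>I\<close> form the exponential family whose statistics are the
  indicators of the points other than a reference point \<open>r\<close>; the natural parameters are
  the log-odds \<open>ln (p i / p r)\<close>.
\<close>

lemma bij_betw_exp_family_open_simplex:
  assumes "finite I" and "r \<in> I"
  shows "bij_betw (exp_family I (I - {r}) (\<lambda>j x. of_bool (x = j)))
           ((I - {r}) \<rightarrow>\<^sub>E UNIV) (open_simplex I)"
proof -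
  let ?J = "I - {r}"
  let ?F = "exp_family I ?J (\<lambda>j x. of_bool (x = j))"
  define Z where "Z \<theta> = (\<Sum>y\<in>I. exp (\<Sum>j\<in>?J. \<theta> j * of_bool (y = j)))" for \<theta> :: "'a \<Rightarrow> real"
  have lin: "(\<Sum>j\<in>?J. \<theta> j * of_bool (x = j)) = (if x \<in> ?J then \<theta> x else 0)"
    for \<theta> :: "'a \<Rightarrow> real" and x
    using assms(1) by (simp add: of_bool_def if_distrib cong: if_cong)
  have Zpos: "Z \<theta> > 0" for \<theta>
    unfolding Z_def using assms by (intro sum_pos) auto
  have F: "?F \<theta> x = exp (if x \<in> ?J then \<theta> x else 0) / Z \<theta>" if "x \<in> I" for \<theta> x
    using that by (simp only: exp_family_def Z_def lin restrict_apply' if_True)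
  show ?thesis
  proof (rule bij_betw_byWitness[where f' = "\<lambda>p. \<lambda>j\<in>?J. ln (p j / p r)"])
    show "\<forall>\<theta>\<in>?J \<rightarrow>\<^sub>E UNIV. (\<lambda>j\<in>?J. ln (?F \<theta> j / ?F \<theta> r)) = \<theta>"
    proof
      fix \<theta> :: "'a \<Rightarrow> real" assume \<theta>: "\<theta> \<in> ?J \<rightarrow>\<^sub>E UNIV"
      have "ln (?F \<theta> j / ?F \<theta> r) = \<theta> j" if "j \<in> ?J" for j
        using that assms Zpos[of \<theta>] by (simp add: F)
      thus "(\<lambda>j\<in>?J. ln (?F \<theta> j / ?F \<theta> r)) = \<theta>"
        using \<theta> by (intro ext) (auto simp: PiE_def extensional_def)
    qed
    show "\<forall>p\<in>open_simplex I. ?F (\<lambda>j\<in>?J. ln (p j / p r)) = p"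
    proof
      fix p assume p: "p \<in> open_simplex I"
      let ?t = "\<lambda>j\<in>?J. ln (p j / p r)"
      have pos: "0 < p i" if "i \<in> I" for i using p that by (simp add: open_simplex_def)
      have e: "exp (if x \<in> ?J then ?t x else 0) = p x / p r" if "x \<in> I" for x
        using that pos assms by (auto simp: less_imp_neq[symmetric])
      have "Z ?t = (\<Sum>x\<in>I. p x / p r)"
        unfolding Z_def lin using e by (intro sum.cong) auto
      also have "\<dots> = 1 / p r"
        using p by (simp add: open_simplex_def flip: sum_divide_distrib)
      finally have "?F ?t x = p x" if "x \<in> I" for x
        using that pos[OF assms(2)] e[OF that] by (simp only: F) simp
      moreover have "?F ?t x = p x" if "x \<notin> I" for x
        using that p by (auto simp: exp_family_def open_simplex_def PiE_def extensional_def)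
      ultimately show "?F ?t = p" by blast
    qed
    show "?F ` (?J \<rightarrow>\<^sub>E UNIV) \<subseteq> open_simplex I"
    proof (clarify)
      fix \<theta> :: "'a \<Rightarrow> real"
      have "(\<Sum>x\<in>I. ?F \<theta> x) = (\<Sum>x\<in>I. exp (\<Sum>j\<in>?J. \<theta> j * of_bool (x = j))) / Z \<theta>"
        by (simp only: exp_family_def Z_def sum_divide_distrib restrict_apply' cong: sum.cong)
      also have "\<dots> = Z \<theta> / Z \<theta>" by (simp only: Z_def)
      also have "\<dots> = 1" using Zpos[of \<theta>] by simp
      finally have "(\<Sum>x\<in>I. ?F \<theta> x) = 1" .
      moreover have "0 < ?F \<theta> x" if "x \<in> I" for x
        using that Zpos[of \<theta>] by (simp only: F) simp
      moreover have "?F \<theta> \<in> I \<rightarrow>\<^sub>E UNIV" by (simp add: exp_family_def)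
      ultimately show "?F \<theta> \<in> open_simplex I" by (simp add: open_simplex_def)
    qed
    show "(\<lambda>p. \<lambda>j\<in>?J. ln (p j / p r)) ` open_simplex I \<subseteq> ?J \<rightarrow>\<^sub>E UNIV"
      by (intro image_subsetI) (simp add: restrict_PiE_iff)
  qed
qed

definition curved_subfamily_of_positive ::
  "'v set \<Rightarrow> ('v \<Rightarrow> nat) \<Rightarrow> (('v \<Rightarrow> nat) \<Rightarrow> real) set \<Rightarrow> bool" where
  "curved_subfamily_of_positive V d M \<longleftrightarrow>
     curved_exp_family (configs V d) (configs V d - {\<lambda>v\<in>V. 1}) (\<lambda>j x. of_bool (x = j)) M"

end

theory Submission
  imports Defs "HOL-Library.Transitive_Closure_Table"
begin

text \<open>
  Order the chain components topologically. The positive distributions are parametrised by the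
  conditional probabilities that \<open>X\<^sub>\<sigma> = j\<^sub>\<sigma>\<close> given all earlier components, for \<open>\<sigma>\<close> a nonempty subset of
  a component and \<open>j\<^sub>v \<noteq> 1\<close> for all \<open>v \<in> \<sigma>\<close>; inclusion-exclusion recovers the distribution from them.
  In these coordinates the model is a graph: the probability of \<open>\<sigma>\<close> is the product of the
  probabilities of the connected pieces of \<open>\<sigma>\<close>, and the probability of a connected set depends only
  on its parents. Subtracting these monomials from the dependent coordinates gives one global slice
  chart. Both the chart and its inverse are built from arithmetic, \<open>exp\<close> and \<open>ln\<close>.
\<close>

section \<open>Elementary functions are smooth\<close>

text \<open>The model equations constrain only coordinates whose states differ from 1, while the
  Markov property speaks about all states. A linear recursion closes this gap: the value with a
  vertex in state 1 is the value without that vertex minus the values with it in other states, so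
  factorisation and dependence on parents alone spread by induction on the number of ones.
  Conditioning on every earlier component, rather than on \<open>parents_D\<close>, gives
  coordinates on all positive distributions and an explicit inverse: a product of kernels that are
  normalised whatever the coordinates are, so that positivity is the only constraint on the range.
  The price is that nondescendants may come later in the chosen order; their independence is
  recovered from the closure of the nondescendants under parents. The chart inverts without an
  implicit function theorem because monomials involve free coordinates only: a connected piece is
  its own only piece, so the subtraction is triangular.\<close>

text \<open>A class of smooth functions that is closed under partial derivatives, so that smoothness
  follows by coinduction and no chain rule in several variables is needed.\<close>

inductive elementary :: "('j \<Rightarrow> real) set \<Rightarrow> 'j set \<Rightarrow> (('j \<Rightarrow> real) \<Rightarrow> real) \<Rightarrow> bool"
  for U J where
  coord: "j \<in> J \<Longrightarrow> elementary U J (\<lambda>x. x j)"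
| const: "elementary U J (\<lambda>x. c)"
| add: "elementary U J f \<Longrightarrow> elementary U J g \<Longrightarrow> elementary U J (\<lambda>x. f x + g x)"
| mult: "elementary U J f \<Longrightarrow> elementary U J g \<Longrightarrow> elementary U J (\<lambda>x. f x * g x)"
| inverse: "elementary U J f \<Longrightarrow> (\<forall>x\<in>U. f x \<noteq> 0) \<Longrightarrow> elementary U J (\<lambda>x. inverse (f x))"
| exp: "elementary U J f \<Longrightarrow> elementary U J (\<lambda>x. exp (f x))"
| ln: "elementary U J f \<Longrightarrow> (\<forall>x\<in>U. 0 < f x) \<Longrightarrow> elementary U J (\<lambda>x. ln (f x))"

lemma elementary_diff:
  "elementary U J f \<Longrightarrow> elementary U J g \<Longrightarrow> elementary U J (\<lambda>x. f x - g x)"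
  using elementary.add[OF _ elementary.mult[OF elementary.const[of U J "-1"]], of f g] by simp

lemma elementary_divide:
  "elementary U J f \<Longrightarrow> elementary U J g \<Longrightarrow> (\<And>x. x \<in> U \<Longrightarrow> g x \<noteq> 0) \<Longrightarrow>
    elementary U J (\<lambda>x. f x / g x)"
  unfolding divide_inverse by (intro elementary.mult elementary.inverse) auto

lemma elementary_sum:
  "(\<And>k. k \<in> S \<Longrightarrow> elementary U J (f k)) \<Longrightarrow> elementary U J (\<lambda>x. \<Sum>k\<in>S. f k x)"
  by (induction S rule: infinite_finite_induct) (auto intro: elementary.intros)

lemma elementary_prod:
  "(\<And>k. k \<in> S \<Longrightarrow> elementary U J (f k)) \<Longrightarrow> elementary U J (\<lambda>x. \<Prod>k\<in>S. f k x)"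
  by (induction S rule: infinite_finite_induct) (auto intro: elementary.intros)

lemma elementary_continuous:
  assumes "elementary U J f"
  shows "continuous_map (subtopology (powertop_real J) U) euclideanreal f"
  using assms
proof (induction rule: elementary.induct)
  case (coord j)
  then show ?case
    by (intro continuous_map_from_subtopology continuous_map_product_projection)
next
  case (exp f)
  have "continuous_map (subtopology (powertop_real J) U) euclideanreal (exp \<circ> f)"
    by (rule continuous_map_compose[OF exp.IH]) (simp add: continuous_on_exp)
  then show ?case by (simp add: o_def)
next
  case (ln f)
  \<comment> \<open>The codomain is narrowed to the positive half-line, on which \<open>ln\<close>
    is continuous, before composing.\<close>
  have "continuous_map (subtopology (powertop_real J) U) (top_of_set {0<..}) f"
    using ln by (auto simp: continuous_map_in_subtopology)
  then have "continuous_map (subtopology (powertop_real J) U) euclideanreal (ln \<circ> f)"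
    by (rule continuous_map_compose) (auto intro!: continuous_intros)
  then show ?case by (simp add: o_def)
qed (auto intro!: continuous_intros)

text \<open>The rules for products, inverses and \<open>exp\<close> return the original functions
  next to their derivatives, so each such case uses membership of \<open>f\<close> itself as well as
  the induction hypothesis. The generator \<open>inverse\<close> provides the derivative of
  \<open>ln\<close>.\<close>

lemma elementary_partial:
  assumes "elementary U J f"
  shows "\<exists>g. elementary U J g \<and>
    (\<forall>x\<in>U. ((\<lambda>t. f (x(j := t))) has_real_derivative g x) (at (x j)))"
  using assms
proof (induction rule: elementary.induct)
  case (coord i)
  show ?case
    by (rule exI[of _ "\<lambda>_. if i = j then 1 else 0"])
      (auto intro: elementary.const)
next
  case (const c)
  show ?case by (rule exI[of _ "\<lambda>_. 0"]) (auto intro: elementary.const)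
next
  case (add f g)
  then obtain f' g' where D: "elementary U J f'" "elementary U J g'"
    "\<And>x. x \<in> U \<Longrightarrow> ((\<lambda>t. f (x(j := t))) has_real_derivative f' x) (at (x j))"
    "\<And>x. x \<in> U \<Longrightarrow> ((\<lambda>t. g (x(j := t))) has_real_derivative g' x) (at (x j))" by blast
  show ?case
    by (intro exI[of _ "\<lambda>x. f' x + g' x"] conjI ballI elementary.add DERIV_add D)
next
  case (mult f g)
  then obtain f' g' where D: "elementary U J f'" "elementary U J g'"
    "\<And>x. x \<in> U \<Longrightarrow> ((\<lambda>t. f (x(j := t))) has_real_derivative f' x) (at (x j))"
    "\<And>x. x \<in> U \<Longrightarrow> ((\<lambda>t. g (x(j := t))) has_real_derivative g' x) (at (x j))" by blast
  have H: "((\<lambda>t. f (x(j := t)) * g (x(j := t))) has_real_derivative f' x * g x + g' x * f x) (at (x j))"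
    if "x \<in> U" for x
    using DERIV_mult[OF D(3,4)[OF that]] by simp
  show ?case
    by (intro exI[of _ "\<lambda>x. f' x * g x + g' x * f x"] conjI ballI H D
      elementary.mult elementary.add elementary.const mult.hyps)
next
  case (inverse f)
  then obtain f' where D: "elementary U J f'"
    "\<And>x. x \<in> U \<Longrightarrow> ((\<lambda>t. f (x(j := t))) has_real_derivative f' x) (at (x j))" by blast
  \<comment> \<open>The sign enters as a constant factor, so that the derivative is visibly
    generated by \<open>const\<close>, \<open>mult\<close> and \<open>inverse\<close>.\<close>
  have H: "((\<lambda>t. inverse (f (x(j := t)))) has_real_derivative
      (-1) * (inverse (f x) * f' x * inverse (f x))) (at (x j))"
    if "x \<in> U" for x
    using DERIV_inverse'[OF D(2)[OF that]] inverse that by simp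
  show ?case
    by (intro exI[of _ "\<lambda>x. (-1) * (inverse (f x) * f' x * inverse (f x))"] conjI ballI H D
      elementary.mult elementary.inverse elementary.const inverse.hyps)
next
  case (exp f)
  then obtain f' where D: "elementary U J f'"
    "\<And>x. x \<in> U \<Longrightarrow> ((\<lambda>t. f (x(j := t))) has_real_derivative f' x) (at (x j))" by blast
  have H: "((\<lambda>t. exp (f (x(j := t)))) has_real_derivative exp (f x) * f' x) (at (x j))"
    if "x \<in> U" for x
    using DERIV_chain2[OF DERIV_exp D(2)[OF that]] by simp
  show ?case
    by (intro exI[of _ "\<lambda>x. exp (f x) * f' x"] conjI ballI H D
      elementary.mult elementary.exp elementary.const exp.hyps)
next
  case (ln f)
  then obtain f' where D: "elementary U J f'"
    "\<And>x. x \<in> U \<Longrightarrow> ((\<lambda>t. f (x(j := t))) has_real_derivative f' x) (at (x j))" by blast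
  have H: "((\<lambda>t. ln (f (x(j := t)))) has_real_derivative inverse (f x) * f' x) (at (x j))"
    if "x \<in> U" for x
    using DERIV_chain2[OF DERIV_ln D(2)[OF that]] ln that by simp
  show ?case
    by (intro exI[of _ "\<lambda>x. inverse (f x) * f' x"] conjI ballI H D
      elementary.mult elementary.inverse elementary.const ln.hyps)  (use ln in force)
qed

lemma elementary_smooth_on: "elementary U J f \<Longrightarrow> smooth_on J U f"
proof (coinduction arbitrary: f rule: smooth_on.coinduct)
  case smooth_on
  note f = this
  have "\<exists>g. (elementary U J g \<or> smooth_on J U g) \<and>
      (\<forall>x\<in>U. ((\<lambda>t. f (x(j := t))) has_real_derivative g x) (at (x j)))" for j
    using elementary_partial[OF f, of j] by (elim exE conjE, intro exI conjI disjI1)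
  then show ?case
    using elementary_continuous[OF f] by simp
qed

section \<open>Summation over configurations\<close>

locale config_space =
  fixes V :: "'v set" and d :: "'v \<Rightarrow> nat"
  assumes finV: "finite V" and d_pos: "\<And>v. v \<in> V \<Longrightarrow> 1 \<le> d v"
begin

abbreviation I where "I \<equiv> configs V d"

text \<open>Summing out the coordinates in \<open>A\<close> leaves a function on all of
  \<open>I\<close> that merely ignores them. Marginals of different sets thus share one domain and
  can be multiplied without projection maps.\<close>

definition integ :: "'v set \<Rightarrow> (('v \<Rightarrow> nat) \<Rightarrow> real) \<Rightarrow> ('v \<Rightarrow> nat) \<Rightarrow> real" where
  "integ A g x = (\<Sum>z | z \<in> I \<and> (\<forall>v\<in>V - A. z v = x v). g z)"

text \<open>Recording the ignored coordinates rather than the used ones matches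
  \<open>integ\<close>: a factor unaffected by \<open>A\<close> can be pulled out of a sum over
  \<open>A\<close>.\<close>

definition unaffected :: "'v set \<Rightarrow> (('v \<Rightarrow> nat) \<Rightarrow> real) \<Rightarrow> bool" where
  "unaffected A g \<longleftrightarrow> (\<forall>x\<in>I. \<forall>y\<in>I. (\<forall>v\<in>V - A. x v = y v) \<longrightarrow> g x = g y)"

abbreviation marg :: "(('v \<Rightarrow> nat) \<Rightarrow> real) \<Rightarrow> 'v set \<Rightarrow> ('v \<Rightarrow> nat) \<Rightarrow> real" where
  "marg p A \<equiv> integ (V - A) p"

lemma finite_I [simp, intro]: "finite I"
  using finV by (simp add: configs_def finite_PiE)

lemma finite_fibre [simp, intro]: "finite {z \<in> I. P z}"
  by (rule finite_subset[OF _ finite_I]) auto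

lemma config_eqI: "x \<in> I \<Longrightarrow> y \<in> I \<Longrightarrow> (\<And>v. v \<in> V \<Longrightarrow> x v = y v) \<Longrightarrow> x = y"
  unfolding configs_def by (rule PiE_ext)

lemma config_update: "x \<in> I \<Longrightarrow> v \<in> V \<Longrightarrow> j \<in> {1..d v} \<Longrightarrow> x(v := j) \<in> I"
  by (auto simp: configs_def PiE_def Pi_def extensional_def)

lemma config_range: "x \<in> I \<Longrightarrow> v \<in> V \<Longrightarrow> x v \<in> {1..d v}"
  by (auto simp: configs_def)

lemma config_override: "x \<in> I \<Longrightarrow> y \<in> I \<Longrightarrow> override_on x y A \<in> I"
  by (auto simp: configs_def PiE_def Pi_def extensional_def override_on_def)

lemma ones_in_I: "(\<lambda>v\<in>V. 1) \<in> I"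
  using d_pos by (auto simp: configs_def)

section \<open>Functions that ignore a set of coordinates\<close>

lemma unaffectedD:
  "unaffected A g \<Longrightarrow> x \<in> I \<Longrightarrow> y \<in> I \<Longrightarrow> (\<And>v. v \<in> V \<Longrightarrow> v \<notin> A \<Longrightarrow> x v = y v) \<Longrightarrow> g x = g y"
  unfolding unaffected_def by blast

lemma unaffected_mono: "unaffected A g \<Longrightarrow> B \<inter> V \<subseteq> A \<Longrightarrow> unaffected B g"
  unfolding unaffected_def by blast

lemma unaffected_mult: "unaffected A g \<Longrightarrow> unaffected A h \<Longrightarrow> unaffected A (\<lambda>x. g x * h x)"
  unfolding unaffected_def by metis

lemma unaffected_divide:
  "unaffected A g \<Longrightarrow> unaffected A h \<Longrightarrow> unaffected A (\<lambda>x. g x / h x)"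
  unfolding unaffected_def by metis

lemma unaffected_cong:
  assumes "\<And>x. x \<in> I \<Longrightarrow> g x = h x" "unaffected A h"
  shows "unaffected A g"
  unfolding unaffected_def
proof (intro ballI impI)
  fix x y assume "x \<in> I" "y \<in> I" "\<forall>v\<in>V - A. x v = y v"
  then show "g x = g y" using assms unfolding unaffected_def by metis
qed

lemma unaffected_prod:
  "(\<And>k. k \<in> S \<Longrightarrow> unaffected A (g k)) \<Longrightarrow> unaffected A (\<lambda>x. \<Prod>k\<in>S. g k x)"
  unfolding unaffected_def by (metis (mono_tags, lifting) prod.cong)

section \<open>Iterated summation over coordinates\<close>

lemma integ_cong: "(\<And>z. z \<in> I \<Longrightarrow> g z = g' z) \<Longrightarrow> integ A g x = integ A g' x"
  by (simp add: integ_def)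

lemma integ_cong_fibre:
  "(\<And>z. z \<in> I \<Longrightarrow> (\<And>v. v \<in> V \<Longrightarrow> v \<notin> A \<Longrightarrow> z v = x v) \<Longrightarrow> g z = g' z) \<Longrightarrow> integ A g x = integ A g' x"
  unfolding integ_def by (rule sum.cong) auto

lemma integ_empty: "x \<in> I \<Longrightarrow> integ {} g x = g x"
proof -
  assume "x \<in> I"
  then have "{z \<in> I. \<forall>v\<in>V. z v = x v} = {x}" by (auto intro: config_eqI)
  then show ?thesis by (simp add: integ_def)
qed

lemma integ_inter: "integ (A \<inter> V) = integ A"
proof -
  have "V - A \<inter> V = V - A" by blast
  then show ?thesis by (simp add: integ_def fun_eq_iff)
qed

lemma integ_UNIV: "integ V g x = (\<Sum>z\<in>I. g z)"
  by (simp add: integ_def)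

lemma integ_Un:
  assumes x: "x \<in> I" and AB: "A \<inter> B = {}"
  shows "integ (A \<union> B) g x = integ A (integ B g) x"
proof -
  have "integ A (integ B g) x =
    (\<Sum>(w, z) \<in> (SIGMA w:{w \<in> I. \<forall>v\<in>V - A. w v = x v}. {z \<in> I. \<forall>v\<in>V - B. z v = w v}). g z)"
    unfolding integ_def by (subst sum.Sigma) auto
  also have "\<dots> = integ (A \<union> B) g x"
    unfolding integ_def
  \<comment> \<open>The pair is determined by \<open>z\<close>: the intermediate point
    \<open>w\<close> equals \<open>x\<close> outside \<open>A\<close>, and on \<open>A\<close> it
    equals \<open>z\<close>, because \<open>z\<close> and \<open>w\<close> differ only in
    \<open>B\<close>.\<close>
  proof (rule sum.reindex_bij_witness[of _ "\<lambda>z. (override_on x z A, z)" snd], goal_cases)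
    case (1 p)
    then obtain w z where p: "p = (w, z)" and w: "w \<in> I" "\<And>v. v \<in> V \<Longrightarrow> v \<notin> A \<Longrightarrow> w v = x v"
      and z: "z \<in> I" "\<And>v. v \<in> V \<Longrightarrow> v \<notin> B \<Longrightarrow> z v = w v" by auto
    have "override_on x z A = w"
    proof (rule config_eqI)
      show "override_on x z A v = w v" if "v \<in> V" for v
        using that w z AB by (cases "v \<in> A") auto
    qed (use x w z config_override in auto)
    then show ?case by (simp add: p)
  next
    case (4 z)
    then show ?case using x config_override by (auto simp: override_on_def)
  qed auto
  finally show ?thesis by simp
qed

lemma unaffected_integ: "unaffected A (integ A g)"
  unfolding unaffected_def integ_def by (auto intro!: sum.cong)

lemma unaffected_integ_other:
  assumes g: "unaffected B g"
  shows "unaffected B (integ A g)"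
  unfolding unaffected_def
proof (intro ballI impI)
  fix x y assume xy: "x \<in> I" "y \<in> I" "\<forall>v\<in>V - B. x v = y v"
  show "integ A g x = integ A g y"
    unfolding integ_def
  \<comment> \<open>The fibres over \<open>x\<close> and \<open>y\<close> are matched by exchanging
    the coordinates outside \<open>A\<close>; there \<open>x\<close> and \<open>y\<close> differ
    only within \<open>B\<close>, which \<open>g\<close> does not see.\<close>
  proof (rule sum.reindex_bij_witness[of _ "\<lambda>z. override_on x z A" "\<lambda>z. override_on y z A"], goal_cases)
    case (1 z)
    then show ?case using xy
      by (intro config_eqI config_override) (auto simp: override_on_def)
  next
    case (3 z)
    then show ?case using xy
      by (intro config_eqI config_override) (auto simp: override_on_def)
  next
    case (5 z)
    then show ?case using xy
      by (intro unaffectedD[OF g] config_override) (auto simp: override_on_def)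
  qed (use xy config_override in auto)
qed

lemma integ_mult:
  assumes "unaffected A g" "x \<in> I"
  shows "integ A (\<lambda>z. g z * h z) x = g x * integ A h x"
  unfolding integ_def sum_distrib_left
proof (rule sum.cong[OF refl])
  fix z assume "z \<in> {z \<in> I. \<forall>v\<in>V - A. z v = x v}"
  then have "g z = g x" using assms by (intro unaffectedD[OF assms(1)]) auto
  then show "g z * h z = g x * h z" by simp
qed

lemma integ_vertex:
  assumes x: "x \<in> I" and v: "v \<in> V"
  shows "integ {v} g x = (\<Sum>j\<in>{1..d v}. g (x(v := j)))"
  unfolding integ_def
proof (rule sum.reindex_bij_witness[of _ "\<lambda>j. x(v := j)" "\<lambda>z. z v"], goal_cases)
  case (1 z) then show ?case using x v by (intro config_eqI config_update config_range) auto
next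
  case (2 z) then show ?case using v config_range by blast
next
  case (4 j) then show ?case using x v config_update by auto
next
  case (5 z)
  then have "x(v := z v) = z" using x v config_range
    by (intro config_eqI config_update config_range) auto
  then show ?case by simp
qed auto

text \<open>State 1 is split off because it is the reference state, which inclusion-exclusion
  expresses through the other states.\<close>

lemma integ_vertex_split:
  assumes x: "x \<in> I" and v: "v \<in> V" and "x v = 1"
  shows "integ {v} g x = g x + (\<Sum>j\<in>{2..d v}. g (x(v := j)))"
proof -
  have S: "{1..d v} = insert 1 {2..d v}" using d_pos[OF v] by auto
  have "x(v := Suc 0) = x" using assms(3) by auto
  then show ?thesis unfolding integ_vertex[OF x v] S by (simp del: fun_upd_apply)
qed

lemma integ_pos:
  assumes "x \<in> I" "\<And>z. z \<in> I \<Longrightarrow> 0 < g z"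
  shows "0 < integ A g x"
  unfolding integ_def using assms by (intro sum_pos) auto

section \<open>Marginals and the calculus of conditional independence\<close>

lemma marg_marg:
  assumes "x \<in> I" "A \<subseteq> B"
  shows "marg p A x = integ (B - A) (marg p B) x"
proof -
  have "V - A = ((B - A) \<inter> V) \<union> (V - B)" using assms by auto
  then have "marg p A x = integ ((B - A) \<inter> V) (marg p B) x"
    using integ_Un[OF assms(1), of "(B - A) \<inter> V" "V - B" p] by auto
  then show ?thesis by (simp only: integ_inter)
qed

lemma marg_unaffected: "B \<inter> A \<inter> V = {} \<Longrightarrow> unaffected B (marg p A)"
  by (rule unaffected_mono[OF unaffected_integ]) auto

text \<open>Conditional independence with the divisions by marginals cleared.\<close>

definition ci :: "(('v \<Rightarrow> nat) \<Rightarrow> real) \<Rightarrow> 'v set \<Rightarrow> 'v set \<Rightarrow> 'v set \<Rightarrow> bool" where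
  "ci p \<alpha> \<beta> \<gamma> \<longleftrightarrow> (\<forall>x\<in>I. marg p (\<alpha> \<union> \<beta> \<union> \<gamma>) x * marg p \<gamma> x =
     marg p (\<alpha> \<union> \<gamma>) x * marg p (\<beta> \<union> \<gamma>) x)"

lemma ciD: "ci p \<alpha> \<beta> \<gamma> \<Longrightarrow> x \<in> I \<Longrightarrow>
    marg p (\<alpha> \<union> \<beta> \<union> \<gamma>) x * marg p \<gamma> x = marg p (\<alpha> \<union> \<gamma>) x * marg p (\<beta> \<union> \<gamma>) x"
  by (simp add: ci_def)

lemma ci_sym: "ci p \<alpha> \<beta> \<gamma> \<Longrightarrow> ci p \<beta> \<alpha> \<gamma>"
  unfolding ci_def by (simp add: Un_commute mult.commute)

text \<open>Both sides of the identity are summed over \<open>\<beta> - \<beta>'\<close>; the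
  factors \<open>marg p \<gamma>\<close> and \<open>marg p (\<alpha> \<union> \<gamma>)\<close> do
  not see these coordinates and come out of the sum.\<close>

lemma ci_decompose_right:
  assumes ci: "ci p \<alpha> \<beta> \<gamma>" and disj: "\<alpha> \<inter> \<beta> = {}" "\<beta> \<inter> \<gamma> = {}" and sub: "\<beta>' \<subseteq> \<beta>"
  shows "ci p \<alpha> \<beta>' \<gamma>"
  unfolding ci_def
proof
  fix x assume x: "x \<in> I"
  define D where "D = \<beta> - \<beta>'"
  have D: "\<alpha> \<union> \<beta> \<union> \<gamma> - (\<alpha> \<union> \<beta>' \<union> \<gamma>) = D" "\<beta> \<union> \<gamma> - (\<beta>' \<union> \<gamma>) = D"
    using disj by (auto simp: D_def)
  have S: "\<alpha> \<union> \<beta>' \<union> \<gamma> \<subseteq> \<alpha> \<union> \<beta> \<union> \<gamma>" "\<beta>' \<union> \<gamma> \<subseteq> \<beta> \<union> \<gamma>" using sub by auto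
  have u: "unaffected D (marg p \<gamma>)" "unaffected D (marg p (\<alpha> \<union> \<gamma>))"
    using disj by (auto intro!: marg_unaffected simp: D_def)
  have "marg p (\<alpha> \<union> \<beta>' \<union> \<gamma>) x * marg p \<gamma> x = integ D (\<lambda>z. marg p \<gamma> z * marg p (\<alpha> \<union> \<beta> \<union> \<gamma>) z) x"
    unfolding marg_marg[OF x S(1)] D(1) integ_mult[OF u(1) x] by (rule mult.commute)
  also have "\<dots> = integ D (\<lambda>z. marg p (\<alpha> \<union> \<gamma>) z * marg p (\<beta> \<union> \<gamma>) z) x"
    using ciD[OF ci] by (intro integ_cong) (simp add: mult.commute)
  also have "\<dots> = marg p (\<alpha> \<union> \<gamma>) x * marg p (\<beta>' \<union> \<gamma>) x"
    unfolding marg_marg[OF x S(2)] D(2) integ_mult[OF u(2) x] ..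
  finally show "marg p (\<alpha> \<union> \<beta>' \<union> \<gamma>) x * marg p \<gamma> x = marg p (\<alpha> \<union> \<gamma>) x * marg p (\<beta>' \<union> \<gamma>) x" .
qed

lemma ci_decompose:
  assumes "ci p \<alpha> \<beta> \<gamma>" "\<alpha> \<inter> \<beta> = {}" "\<beta> \<inter> \<gamma> = {}" "\<alpha> \<inter> \<gamma> = {}" "\<alpha>' \<subseteq> \<alpha>" "\<beta>' \<subseteq> \<beta>"
  shows "ci p \<alpha>' \<beta>' \<gamma>"
proof -
  have "ci p \<beta>' \<alpha> \<gamma>"
    using assms by (intro ci_sym[OF ci_decompose_right[of p \<alpha> \<beta>]]) auto
  moreover have "\<beta>' \<inter> \<alpha> = {}" using assms by auto
  ultimately show ?thesis
    using ci_sym[OF ci_decompose_right[of p \<beta>' \<alpha> \<gamma> \<alpha>']] assms by simp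
qed

text \<open>Factorisation criterion; the factors need not be probabilities. Summing out
  \<open>\<beta>\<close> leaves \<open>g\<close> times a sum of \<open>h\<close>, summing out
  \<open>\<alpha>\<close> leaves \<open>h\<close> times a sum of \<open>g\<close>, and summing out
  both leaves the product of the two sums.\<close>

lemma ci_factorI:
  assumes disj: "\<alpha> \<inter> \<beta> = {}" "\<beta> \<inter> \<gamma> = {}" "\<alpha> \<inter> \<gamma> = {}"
    and fac: "\<And>x. x \<in> I \<Longrightarrow> marg p (\<alpha> \<union> \<beta> \<union> \<gamma>) x = g x * h x"
    and g: "unaffected \<beta> g" and h: "unaffected \<alpha> h"
  shows "ci p \<alpha> \<beta> \<gamma>"
  unfolding ci_def
proof
  fix x assume x: "x \<in> I"
  have D: "\<alpha> \<union> \<beta> \<union> \<gamma> - (\<alpha> \<union> \<gamma>) = \<beta>" "\<alpha> \<union> \<beta> \<union> \<gamma> - (\<beta> \<union> \<gamma>) = \<alpha>" "\<alpha> \<union> \<gamma> - \<gamma> = \<alpha>"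
    using disj by auto
  have m1: "marg p (\<alpha> \<union> \<gamma>) z = g z * integ \<beta> h z" if z: "z \<in> I" for z
  proof -
    have "marg p (\<alpha> \<union> \<gamma>) z = integ \<beta> (marg p (\<alpha> \<union> \<beta> \<union> \<gamma>)) z"
      using marg_marg[OF z, of "\<alpha> \<union> \<gamma>" "\<alpha> \<union> \<beta> \<union> \<gamma>" p] D by (auto simp: Un_ac)
    also have "\<dots> = integ \<beta> (\<lambda>x. g x * h x) z" using fac by (intro integ_cong) auto
    finally show ?thesis using integ_mult[OF g z] by simp
  qed
  have m2: "marg p (\<beta> \<union> \<gamma>) z = h z * integ \<alpha> g z" if z: "z \<in> I" for z
  proof -
    have "marg p (\<beta> \<union> \<gamma>) z = integ \<alpha> (marg p (\<alpha> \<union> \<beta> \<union> \<gamma>)) z"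
      using marg_marg[OF z, of "\<beta> \<union> \<gamma>" "\<alpha> \<union> \<beta> \<union> \<gamma>" p] D by (auto simp: Un_ac)
    also have "\<dots> = integ \<alpha> (\<lambda>x. h x * g x) z" using fac by (intro integ_cong) auto
    finally show ?thesis using integ_mult[OF h z] by simp
  qed
  have "marg p \<gamma> x = integ \<alpha> (marg p (\<alpha> \<union> \<gamma>)) x"
    using marg_marg[OF x, of \<gamma> "\<alpha> \<union> \<gamma>" p] D by auto
  also have "\<dots> = integ \<alpha> (\<lambda>z. integ \<beta> h z * g z) x"
    using m1 by (intro integ_cong) simp
  also have "\<dots> = integ \<beta> h x * integ \<alpha> g x"
    by (rule integ_mult[OF unaffected_integ_other[OF h] x])
  finally show "marg p (\<alpha> \<union> \<beta> \<union> \<gamma>) x * marg p \<gamma> x = marg p (\<alpha> \<union> \<gamma>) x * marg p (\<beta> \<union> \<gamma>) x"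
    by (simp add: fac[OF x] m1[OF x] m2[OF x])
qed

section \<open>From conditional probabilities to products of marginals\<close>

lemma restrict_eq_iff: "restrict x A = restrict y A \<longleftrightarrow> (\<forall>v\<in>A. x v = y v)"
  by (metis restrict_apply' restrict_ext)

lemma measure_agree:
  assumes p: "\<And>i. i \<in> I \<Longrightarrow> 0 < p i" and A: "A \<subseteq> V"
  shows "measure (point_measure I (\<lambda>x. ennreal (p x)))
    {x \<in> space (point_measure I (\<lambda>x. ennreal (p x))). restrict x A = restrict y A} = marg p A y"
proof -
  have "V - (V - A) = A" using A by auto
  then have eq: "{x \<in> I. restrict x A = restrict y A} = {z \<in> I. \<forall>v\<in>V - (V - A). z v = y v}"
    by (simp add: restrict_eq_iff)
  have "measure (point_measure I (\<lambda>x. ennreal (p x))) {x \<in> I. restrict x A = restrict y A} =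
    (\<Sum>x | x \<in> I \<and> restrict x A = restrict y A. p x)"
    using p by (subst measure_point_measure_finite_if) (auto simp: less_imp_le)
  then show ?thesis by (simp add: space_point_measure integ_def eq)
qed

text \<open>The values on \<alpha>, \<beta> and \<gamma> come from three configurations. As the sets
  are disjoint, \<open>comb\<close> merges the three into one; conversely a single configuration can
  serve in all three roles. Positivity of the conditioning marginal lets the denominators be
  cleared.\<close>

lemma cond_indep_iff_ci:
  assumes p: "\<And>i. i \<in> I \<Longrightarrow> 0 < p i" and sub: "\<alpha> \<subseteq> V" "\<beta> \<subseteq> V" "\<gamma> \<subseteq> V"
    and disj: "\<alpha> \<inter> \<beta> = {}" "\<beta> \<inter> \<gamma> = {}" "\<alpha> \<inter> \<gamma> = {}"
  shows "cond_indep I p \<alpha> \<beta> \<gamma> \<longleftrightarrow> ci p \<alpha> \<beta> \<gamma>"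
proof -
  let ?M = "point_measure I (\<lambda>x. ennreal (p x))"
  define comb where "comb a b c = override_on (override_on c a \<alpha>) b \<beta>" for a b c :: "'v \<Rightarrow> nat"
  have comb_in: "comb a b c \<in> I" if "a \<in> I" "b \<in> I" "c \<in> I" for a b c
    using that by (simp add: comb_def config_override)
  have comb: "v \<in> \<alpha> \<Longrightarrow> comb a b c v = a v" "v \<in> \<beta> \<Longrightarrow> comb a b c v = b v"
      "v \<in> \<gamma> \<Longrightarrow> comb a b c v = c v" for v a b c
    using disj by (auto simp: comb_def override_on_def)
  have e1: "(restrict x \<alpha> = restrict a \<alpha> \<and> restrict x \<beta> = restrict b \<beta>) \<and> restrict x \<gamma> = restrict c \<gamma>
      \<longleftrightarrow> restrict x (\<alpha> \<union> \<beta> \<union> \<gamma>) = restrict (comb a b c) (\<alpha> \<union> \<beta> \<union> \<gamma>)" for x a b c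
    unfolding restrict_eq_iff by (simp add: ball_Un comb cong: ball_cong)
  have e2: "restrict x \<alpha> = restrict a \<alpha> \<and> restrict x \<gamma> = restrict c \<gamma>
      \<longleftrightarrow> restrict x (\<alpha> \<union> \<gamma>) = restrict (comb a b c) (\<alpha> \<union> \<gamma>)" for x a b c
    unfolding restrict_eq_iff by (simp add: ball_Un comb cong: ball_cong)
  have e3: "restrict x \<beta> = restrict b \<beta> \<and> restrict x \<gamma> = restrict c \<gamma>
      \<longleftrightarrow> restrict x (\<beta> \<union> \<gamma>) = restrict (comb a b c) (\<beta> \<union> \<gamma>)" for x a b c
    unfolding restrict_eq_iff by (simp add: ball_Un comb cong: ball_cong)
  have e4: "restrict x \<gamma> = restrict c \<gamma> \<longleftrightarrow> restrict x \<gamma> = restrict (comb a b c) \<gamma>" for x a b c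
    unfolding restrict_eq_iff by (simp add: comb cong: ball_cong)
  have c1: "cond_prob ?M (\<lambda>x. restrict x \<alpha> = restrict a \<alpha> \<and> restrict x \<beta> = restrict b \<beta>)
       (\<lambda>x. restrict x \<gamma> = restrict c \<gamma>) =
       marg p (\<alpha> \<union> \<beta> \<union> \<gamma>) (comb a b c) / marg p \<gamma> (comb a b c)" for a b c
    unfolding cond_prob_def e1 unfolding e4[of _ c a b] using sub p by (simp add: measure_agree)
  have c2: "cond_prob ?M (\<lambda>x. restrict x \<alpha> = restrict a \<alpha>) (\<lambda>x. restrict x \<gamma> = restrict c \<gamma>) =
       marg p (\<alpha> \<union> \<gamma>) (comb a b c) / marg p \<gamma> (comb a b c)" for a b c
    unfolding cond_prob_def e2[of _ a c b] unfolding e4[of _ c a b] using sub p by (simp add: measure_agree)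
  have c3: "cond_prob ?M (\<lambda>x. restrict x \<beta> = restrict b \<beta>) (\<lambda>x. restrict x \<gamma> = restrict c \<gamma>) =
       marg p (\<beta> \<union> \<gamma>) (comb a b c) / marg p \<gamma> (comb a b c)" for a b c
    unfolding cond_prob_def e3[of _ b c a] unfolding e4[of _ c a b] using sub p by (simp add: measure_agree)
  have pos: "0 < marg p \<gamma> x" if "x \<in> I" for x using that p by (rule integ_pos)
  have div: "u / s = t / s * (w / s) \<longleftrightarrow> u * s = t * w" if "0 < s" for u s t w :: real
    using that by (auto simp: field_simps)
  have self: "comb x x x = x" for x by (auto simp: comb_def override_on_def)
  let ?C = "\<lambda>x. marg p (\<alpha> \<union> \<beta> \<union> \<gamma>) x / marg p \<gamma> x =
     marg p (\<alpha> \<union> \<gamma>) x / marg p \<gamma> x * (marg p (\<beta> \<union> \<gamma>) x / marg p \<gamma> x)"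
  have "cond_indep I p \<alpha> \<beta> \<gamma> \<longleftrightarrow> (\<forall>a\<in>I. \<forall>b\<in>I. \<forall>c\<in>I. ?C (comb a b c))"
    unfolding cond_indep_def
  proof (intro ball_cong refl, goal_cases)
    case (1 a b c)
    show ?case unfolding c1[of a b c] c2[of a c b] c3[of b c a] ..
  qed
  also have "\<dots> \<longleftrightarrow> (\<forall>x\<in>I. ?C x)"
  proof (intro iffI ballI)
    fix x assume "\<forall>a\<in>I. \<forall>b\<in>I. \<forall>c\<in>I. ?C (comb a b c)" and x: "x \<in> I"
    then have "?C (comb x x x)" by blast
    then show "?C x" by (simp only: self)
  next
    fix a b c assume C: "\<forall>x\<in>I. ?C x" and "a \<in> I" "b \<in> I" "c \<in> I"
    then have "comb a b c \<in> I" by (intro comb_in)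
    then show "?C (comb a b c)" by (rule C[THEN bspec])
  qed
  also have "\<dots> \<longleftrightarrow> ci p \<alpha> \<beta> \<gamma>"
    unfolding ci_def by (rule ball_cong[OF refl div[OF pos]])
  finally show ?thesis .
qed

text \<open>Inclusion-exclusion one vertex at a time: \<open>vsum\<close> turns the probability that \<open>X\<^sub>v = 1\<close> into the
  probability that \<open>X\<^sub>v\<close> is arbitrary, and \<open>vdiff\<close> undoes this.\<close>

definition vsum :: "'v \<Rightarrow> (('v \<Rightarrow> nat) \<Rightarrow> real) \<Rightarrow> ('v \<Rightarrow> nat) \<Rightarrow> real" where
  "vsum v g x = (if x v = 1 then integ {v} g x else g x)"

definition vdiff :: "'v \<Rightarrow> (('v \<Rightarrow> nat) \<Rightarrow> real) \<Rightarrow> ('v \<Rightarrow> nat) \<Rightarrow> real" where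
  "vdiff v g x = (if x v = 1 then g x - (\<Sum>j\<in>{2..d v}. g (x(v := j))) else g x)"

fun vsums :: "'v list \<Rightarrow> (('v \<Rightarrow> nat) \<Rightarrow> real) \<Rightarrow> ('v \<Rightarrow> nat) \<Rightarrow> real" where
  "vsums [] g = g"
| "vsums (v # vs) g = vsums vs (vsum v g)"

text \<open>The head acts first in \<open>vsums\<close> and last in \<open>vdiffs\<close>, so each
  step cancels against its own inverse and no two vertices have to be exchanged.\<close>

fun vdiffs :: "'v list \<Rightarrow> (('v \<Rightarrow> nat) \<Rightarrow> real) \<Rightarrow> ('v \<Rightarrow> nat) \<Rightarrow> real" where
  "vdiffs [] g = g"
| "vdiffs (v # vs) g = vdiff v (vdiffs vs g)"

lemma vsum_vdiff:
  assumes x: "x \<in> I" and v: "v \<in> V"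
  shows "vsum v (vdiff v g) x = g x"
proof (cases "x v = 1")
  case True
  have "vsum v (vdiff v g) x = vdiff v g x + (\<Sum>j\<in>{2..d v}. vdiff v g (x(v := j)))"
    using integ_vertex_split[OF x v True] True by (simp add: vsum_def)
  also have "(\<Sum>j\<in>{2..d v}. vdiff v g (x(v := j))) = (\<Sum>j\<in>{2..d v}. g (x(v := j)))"
    by (intro sum.cong) (auto simp: vdiff_def)
  also have "vdiff v g x + (\<Sum>j\<in>{2..d v}. g (x(v := j))) = g x"
    using True by (simp add: vdiff_def)
  finally show ?thesis .
qed (simp add: vsum_def vdiff_def)

lemma vdiff_vsum:
  assumes x: "x \<in> I" and v: "v \<in> V"
  shows "vdiff v (vsum v g) x = g x"
proof (cases "x v = 1")
  case True
  have "(\<Sum>j\<in>{2..d v}. vsum v g (x(v := j))) = (\<Sum>j\<in>{2..d v}. g (x(v := j)))"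
    by (intro sum.cong) (auto simp: vsum_def)
  then show ?thesis using integ_vertex_split[OF x v True] True by (simp add: vdiff_def vsum_def)
qed (simp add: vsum_def vdiff_def)

lemma vsum_cong: "(\<And>x. x \<in> I \<Longrightarrow> g x = g' x) \<Longrightarrow> x \<in> I \<Longrightarrow> vsum v g x = vsum v g' x"
  using integ_cong[of g g' "{v}" x] by (simp add: vsum_def)

lemma vdiff_cong:
  assumes g: "\<And>x. x \<in> I \<Longrightarrow> g x = g' x" and x: "x \<in> I" and v: "v \<in> V"
  shows "vdiff v g x = vdiff v g' x"
proof -
  have "g (x(v := j)) = g' (x(v := j))" if "j \<in> {2..d v}" for j
    using that by (intro g config_update x v) auto
  then show ?thesis using g[OF x] by (simp add: vdiff_def del: fun_upd_apply)
qed

lemma vsums_cong: "(\<And>x. x \<in> I \<Longrightarrow> g x = g' x) \<Longrightarrow> x \<in> I \<Longrightarrow> vsums vs g x = vsums vs g' x"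
proof (induction vs arbitrary: g g')
  case (Cons v vs)
  have "vsums vs (vsum v g) x = vsums vs (vsum v g') x"
    using Cons.prems by (intro Cons.IH vsum_cong)
  then show ?case by simp
qed simp

lemma vdiffs_cong:
  "(\<And>x. x \<in> I \<Longrightarrow> g x = g' x) \<Longrightarrow> x \<in> I \<Longrightarrow> set vs \<subseteq> V \<Longrightarrow> vdiffs vs g x = vdiffs vs g' x"
proof (induction vs arbitrary: x)
  case (Cons v vs)
  then show ?case by (simp, intro vdiff_cong) auto
qed simp

lemma vsums_vdiffs: "x \<in> I \<Longrightarrow> set vs \<subseteq> V \<Longrightarrow> vsums vs (vdiffs vs g) x = g x"
proof (induction vs arbitrary: x)
  case (Cons v vs)
  have "vsums vs (vsum v (vdiff v (vdiffs vs g))) x = vsums vs (vdiffs vs g) x"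
    using Cons.prems by (intro vsums_cong vsum_vdiff) auto
  then show ?case using Cons by simp
qed simp

lemma vdiffs_vsums: "x \<in> I \<Longrightarrow> set vs \<subseteq> V \<Longrightarrow> vdiffs vs (vsums vs g) x = g x"
proof (induction vs arbitrary: x g)
  case (Cons v vs)
  have "vdiff v (vdiffs vs (vsums vs (vsum v g))) x = vdiff v (vsum v g) x"
    using Cons by (intro vdiff_cong) auto
  then show ?case using Cons.prems vdiff_vsum by simp
qed simp

text \<open>At \<open>x\<close>, a vertex in state 1 is summed out and any other keeps its state, so
  one function on configurations holds the marginals over all subsets of \<open>vs\<close>.
  Distinctness prevents a vertex from being summed twice.\<close>

lemma vsums_eq_integ:
  "x \<in> I \<Longrightarrow> set vs \<subseteq> V \<Longrightarrow> distinct vs \<Longrightarrow> vsums vs g x = integ {v \<in> set vs. x v = 1} g x"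
proof (induction vs arbitrary: g)
  case Nil
  then show ?case by (simp add: integ_empty)
next
  case (Cons v vs)
  let ?A = "{u \<in> set vs. x u = 1}"
  have v: "v \<in> V" "v \<notin> ?A" using Cons.prems by auto
  have "vsums (v # vs) g x = integ ?A (vsum v g) x" using Cons by simp
  also have "\<dots> = integ {u \<in> set (v # vs). x u = 1} g x"
  proof (cases "x v = 1")
    case True
    have "integ ?A (vsum v g) x = integ ?A (integ {v} g) x"
      using v True by (intro integ_cong_fibre) (simp add: vsum_def)
    also have "\<dots> = integ (?A \<union> {v}) g x"
      using v integ_Un[OF Cons.prems(1), of ?A "{v}"] by simp
    also have "?A \<union> {v} = {u \<in> set (v # vs). x u = 1}" using True by auto
    finally show ?thesis .
  next
    case False
    have "integ ?A (vsum v g) x = integ ?A g x"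
      using v False by (intro integ_cong_fibre) (simp add: vsum_def)
    also have "\<dots> = integ {u \<in> set (v # vs). x u = 1} g x"
      using False by (intro arg_cong[of _ _ "\<lambda>A. integ A g x"]) auto
    finally show ?thesis .
  qed
  finally show ?case .
qed

lemma unaffected_vdiff:
  assumes g: "unaffected A g" and v: "v \<in> V" "v \<notin> A"
  shows "unaffected A (vdiff v g)"
  unfolding unaffected_def
proof (intro ballI impI)
  fix x y assume xy: "x \<in> I" "y \<in> I" "\<forall>u\<in>V - A. x u = y u"
  have "g (x(v := j)) = g (y(v := j))" if "j \<in> {1..d v}" for j
    using xy v that by (intro unaffectedD[OF g] config_update) auto
  moreover have "g x = g y" using xy by (intro unaffectedD[OF g]) auto
  moreover have "x v = y v" using xy v by auto
  ultimately show "vdiff v g x = vdiff v g y"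
    by (simp add: vdiff_def del: fun_upd_apply)
qed

lemma unaffected_vdiffs:
  "unaffected A g \<Longrightarrow> set vs \<subseteq> V \<Longrightarrow> set vs \<inter> A = {} \<Longrightarrow> unaffected A (vdiffs vs g)"
  by (induction vs) (auto intro: unaffected_vdiff)

lemma elementary_vdiffs:
  "(\<And>x. x \<in> I \<Longrightarrow> elementary U J (\<lambda>y. g y x)) \<Longrightarrow> x \<in> I \<Longrightarrow> set vs \<subseteq> V \<Longrightarrow>
    elementary U J (\<lambda>y. vdiffs vs (g y) x)"
proof (induction vs arbitrary: x)
  case (Cons v vs)
  have "elementary U J (\<lambda>y. vdiffs vs (g y) (x(v := j)))" if "j \<in> {2..d v}" for j
    using Cons that by (intro Cons.IH config_update) auto
  moreover have "elementary U J (\<lambda>y. vdiffs vs (g y) x)" using Cons by simp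
  ultimately show ?case
    by (cases "x v = 1")
      (auto simp: vdiff_def simp del: fun_upd_apply intro!: elementary_diff elementary_sum)
qed simp

end

section \<open>Topological ordering of the chain components\<close>

text \<open>A path from \<open>w\<close> back to \<open>v\<close>, made free of repetitions, would
  be closed by the directed edge to a semi-directed cycle.\<close>

lemma chain_graph_no_return:
  assumes G: "chain_graph V E" and vw: "directed E v w"
  shows "(w, v) \<notin> E\<^sup>*"
proof
  assume "(w, v) \<in> E\<^sup>*"
  then have "(\<lambda>a b. (a, b) \<in> E)\<^sup>*\<^sup>* w v" by (simp add: rtranclp_rtrancl_eq)
  then obtain ys where "rtrancl_path (\<lambda>a b. (a, b) \<in> E) w ys v"
    by (auto simp: rtranclp_eq_rtrancl_path)
  then obtain xs where xs: "rtrancl_path (\<lambda>a b. (a, b) \<in> E) w xs v" "distinct (w # xs)"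
    by (rule rtrancl_path_distinct)
  have "v \<noteq> w" using vw by (auto simp: directed_def)
  then have ne: "xs \<noteq> []" using xs(1) by (auto elim: rtrancl_path.cases)
  have last: "(w # xs) ! length xs = v"
    using rtrancl_path_last[OF xs(1) ne] ne by (simp add: last_conv_nth)
  \<comment> \<open>The index \<open>length xs\<close> is that of \<open>v\<close>; there the
    successor wraps round to \<open>w\<close> and gives the closing edge.\<close>
  have "((w # xs) ! i, (w # xs) ! (Suc i mod length (w # xs))) \<in> E" if "i < length (w # xs)" for i
  proof (cases "i = length xs")
    case True
    then show ?thesis using last vw by (simp add: directed_def)
  next
    case False
    then have i: "i < length xs" using that by simp
    then show ?thesis using rtrancl_path_nth[OF xs(1) i] by simp
  qed
  moreover have "directed E ((w # xs) ! length xs) ((w # xs) ! (Suc (length xs) mod length (w # xs)))"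
    using last vw by simp
  ultimately have "semi_directed_cycle E (w # xs)"
    unfolding semi_directed_cycle_def using xs(2) by (metis length_Cons lessI list.distinct(1))
  then show False using G by (auto simp: chain_graph_def)
qed

text \<open>Chain components are the strongly connected components of \<open>E\<close>: an edge on a
  path that can be travelled back cannot be directed.\<close>

lemma chain_graph_undirected_path_iff:
  assumes G: "chain_graph V E"
  shows "(undirected E)\<^sup>*\<^sup>* v w \<longleftrightarrow> (v, w) \<in> E\<^sup>* \<and> (w, v) \<in> E\<^sup>*"
proof
  assume "(undirected E)\<^sup>*\<^sup>* v w"
  then show "(v, w) \<in> E\<^sup>* \<and> (w, v) \<in> E\<^sup>*"
  proof induction
    case (step y z)
    then have "(y, z) \<in> E" "(z, y) \<in> E" by (auto simp: undirected_def)
    then show ?case using step.IH by (meson converse_rtrancl_into_rtrancl rtrancl.rtrancl_into_rtrancl)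
  qed auto
next
  have "(v, w) \<in> E\<^sup>* \<Longrightarrow> (w, v) \<in> E\<^sup>* \<Longrightarrow> (undirected E)\<^sup>*\<^sup>* v w"
  proof (induction rule: rtrancl_induct)
    case (step y z)
    then have "(z, y) \<in> E\<^sup>*" by (meson rtrancl_trans)
    then have "undirected E y z"
      using chain_graph_no_return[OF G, of y z] step.hyps(2) by (auto simp: directed_def undirected_def)
    moreover have "(y, v) \<in> E\<^sup>*" using step by (meson converse_rtrancl_into_rtrancl)
    ultimately show ?case using step.IH by (meson rtranclp.rtrancl_into_rtrancl)
  qed simp
  then show "(v, w) \<in> E\<^sup>* \<and> (w, v) \<in> E\<^sup>* \<Longrightarrow> (undirected E)\<^sup>*\<^sup>* v w" by blast
qed

text \<open>Count the predecessors of a vertex, and break ties between components by the least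
  label occurring in them.\<close>

lemma chain_graph_ranking:
  assumes G: "chain_graph V E"
  obtains rk :: "'v \<Rightarrow> nat" and m where
    "\<And>v w. directed E v w \<Longrightarrow> rk v < rk w"
    "\<And>v w. v \<in> V \<Longrightarrow> w \<in> V \<Longrightarrow> rk v = rk w \<longleftrightarrow> (undirected E)\<^sup>*\<^sup>* v w"
    "\<And>v. v \<in> V \<Longrightarrow> rk v < m"
proof -
  have fin: "finite V" and E: "E \<subseteq> V \<times> V" using G by (auto simp: chain_graph_def)
  define N where "N = card V"
  obtain num where num: "bij_betw num V {0..<N}" using ex_bij_betw_finite_nat[OF fin] N_def by blast
  define cl where "cl v = {w \<in> V. (v, w) \<in> E\<^sup>* \<and> (w, v) \<in> E\<^sup>*}" for v
  define P where "P v = card {u \<in> V. (u, v) \<in> E\<^sup>*}" for v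
  define c where "c v = Min (num ` cl v)" for v
  \<comment> \<open>Since \<open>c v < N\<close> for every vertex, this orders lexicographically by
    \<open>P\<close> and then by label, and reduction modulo \<open>N\<close> returns the
    label.\<close>
  define rk where "rk v = P v * N + c v" for v
  have fcl: "finite (cl v)" for v using fin by (simp add: cl_def)
  have c_in: "c v \<in> num ` cl v" if "v \<in> V" for v
    unfolding c_def using that by (intro Min_in finite_imageI fcl) (auto simp: cl_def)
  have c_less: "c v < N" if "v \<in> V" for v
    using c_in[OF that] num by (auto simp: bij_betw_def cl_def)
  have P_mono: "P v \<le> P w" if "(v, w) \<in> E\<^sup>*" for v w
    unfolding P_def using that fin by (intro card_mono) (auto intro: rtrancl_trans)
  have less: "rk v < rk w" if "directed E v w" for v w
  proof -
    have vw: "v \<in> V" "w \<in> V" "(v, w) \<in> E" using that E by (auto simp: directed_def)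
    have "w \<notin> {u \<in> V. (u, v) \<in> E\<^sup>*}" using chain_graph_no_return[OF G that] by simp
    then have "{u \<in> V. (u, v) \<in> E\<^sup>*} \<subset> {u \<in> V. (u, w) \<in> E\<^sup>*}"
      using vw by (auto intro: rtrancl_into_rtrancl)
    then have "P v < P w" unfolding P_def by (intro psubset_card_mono) (use fin in auto)
    then have "Suc (P v) * N \<le> P w * N" by (intro mult_le_mono1) simp
    then show ?thesis using c_less[OF vw(1)] unfolding rk_def by simp
  qed
  have eq: "rk v = rk w \<longleftrightarrow> (undirected E)\<^sup>*\<^sup>* v w" if v: "v \<in> V" and w: "w \<in> V" for v w
    unfolding chain_graph_undirected_path_iff[OF G]
  proof
    \<comment> \<open>The label alone decides: the vertex that carries it lies in both
      classes.\<close>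
    assume "rk v = rk w"
    then have "rk v mod N = rk w mod N" by simp
    then have "c v = c w" using c_less[OF v] c_less[OF w] by (simp add: rk_def)
    with c_in[OF v] c_in[OF w] obtain a b where ab: "a \<in> cl v" "b \<in> cl w" "num a = num b" by auto
    then have "a = b" using num by (auto simp: bij_betw_def inj_on_def cl_def)
    with ab show "(v, w) \<in> E\<^sup>* \<and> (w, v) \<in> E\<^sup>*" by (auto simp: cl_def intro: rtrancl_trans)
  next
    assume vw: "(v, w) \<in> E\<^sup>* \<and> (w, v) \<in> E\<^sup>*"
    then have "P v = P w" using P_mono by (intro antisym) auto
    moreover have "cl v = cl w" using vw by (auto simp: cl_def intro: rtrancl_trans)
    ultimately show "rk v = rk w" by (simp add: rk_def c_def)
  qed
  obtain m where "\<forall>k\<in>rk ` V. k < m"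
    using finite_imageI[OF fin, of rk] finite_nat_set_iff_bounded by blast
  then show ?thesis using less eq by (intro that[of rk m]) blast+
qed

section \<open>Chain components as level sets of a rank function\<close>

locale ranked_chain_graph = config_space V d
  for V :: "'v set" and d :: "'v \<Rightarrow> nat" +
  fixes E :: "('v \<times> 'v) set" and rk :: "'v \<Rightarrow> nat" and m :: nat
  assumes E_sub: "E \<subseteq> V \<times> V"
    and rk_directed: "\<And>v w. directed E v w \<Longrightarrow> rk v < rk w"
    and rk_eq_iff: "\<And>v w. v \<in> V \<Longrightarrow> w \<in> V \<Longrightarrow> rk v = rk w \<longleftrightarrow> (undirected E)\<^sup>*\<^sup>* v w"
    and rk_less: "\<And>v. v \<in> V \<Longrightarrow> rk v < m"
begin

text \<open>Ranks may skip numbers; \<open>block k\<close> is then empty and contributes a trivial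
  factor to products over all \<open>k\<close>.\<close>

definition block where "block k = {v \<in> V. rk v = k}"
definition below where "below k = {v \<in> V. rk v < k}"

lemma block_sub: "block k \<subseteq> V" and below_sub: "below k \<subseteq> V"
  by (auto simp: block_def below_def)

lemma block_below: "block k \<inter> below k = {}"
  by (auto simp: block_def below_def)

lemma finite_block: "finite (block k)"
  using finV by (simp add: block_def)

lemma directed_in_V: "directed E v w \<Longrightarrow> v \<in> V \<and> w \<in> V"
  using E_sub by (auto simp: directed_def)

lemma chain_components_eq: "chain_components V E = block ` (rk ` V)"
proof -
  have "{(v, w) \<in> V \<times> V. (undirected E)\<^sup>*\<^sup>* v w} `` {v} = block (rk v)" if "v \<in> V" for v
    using that rk_eq_iff[OF that] by (auto simp: block_def simp flip: rk_eq_iff)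
  then show ?thesis unfolding chain_components_def quotient_def by auto
qed

text \<open>A parent has strictly smaller rank, so inside one component the set difference in the
  definition of \<open>parents\<close> removes nothing.\<close>

lemma mem_parents_iff: "\<sigma> \<subseteq> block k \<Longrightarrow> u \<in> parents E \<sigma> \<longleftrightarrow> (\<exists>v\<in>\<sigma>. directed E u v)"
proof -
  assume \<sigma>: "\<sigma> \<subseteq> block k"
  have "u \<notin> \<sigma>" if "v \<in> \<sigma>" "directed E u v" for v
  proof
    assume "u \<in> \<sigma>"
    then have "rk u = rk v" using \<sigma> that(1) by (auto simp: block_def)
    then show False using rk_directed[OF that(2)] by simp
  qed
  then show ?thesis by (auto simp: parents_def)
qed

lemma parents_below: "\<sigma> \<subseteq> block k \<Longrightarrow> parents E \<sigma> \<subseteq> below k"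
  using directed_in_V rk_directed by (fastforce simp: mem_parents_iff below_def block_def)

lemma parents_mono: "\<sigma> \<subseteq> \<rho> \<Longrightarrow> \<rho> \<subseteq> block k \<Longrightarrow> parents E \<sigma> \<subseteq> parents E \<rho>"
  using mem_parents_iff[of \<sigma> k] mem_parents_iff[of \<rho> k] by blast

section \<open>The component digraph and nondescendants in terms of ranks\<close>

lemma component_dag_iff:
  assumes "v \<in> V" "w \<in> V"
  shows "(block (rk v), block (rk w)) \<in> component_dag V E \<longleftrightarrow>
    (\<exists>a\<in>block (rk v). \<exists>b\<in>block (rk w). directed E a b)"
  using assms by (auto simp: component_dag_def chain_components_eq)

lemma parents_D_bounds:
  assumes "k \<in> rk ` V"
  shows "parents E (block k) \<subseteq> parents_D V E (block k)" "parents_D V E (block k) \<subseteq> below k"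
proof -
  show "parents E (block k) \<subseteq> parents_D V E (block k)"
  proof
    fix u assume "u \<in> parents E (block k)"
    then obtain v where v: "v \<in> block k" "directed E u v" by (auto simp: parents_def)
    then have "(block (rk u), block (rk v)) \<in> component_dag V E"
      using directed_in_V by (subst component_dag_iff) (auto simp: block_def)
    moreover have "u \<in> block (rk u)" using directed_in_V[OF v(2)] by (simp add: block_def)
    ultimately show "u \<in> parents_D V E (block k)"
      using v(1) by (auto simp: parents_D_def block_def)
  qed
  show "parents_D V E (block k) \<subseteq> below k"
    using rk_directed by (fastforce simp: parents_D_def component_dag_def chain_components_eq
        block_def below_def)
qed

lemma component_dag_trancl_rank:
  "(A, B) \<in> (component_dag V E)\<^sup>+ \<Longrightarrow> \<forall>a\<in>A. \<forall>b\<in>B. rk a < rk b"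
proof (induction rule: trancl_induct)
  case (base B)
  then show ?case using rk_directed
    by (fastforce simp: component_dag_def chain_components_eq block_def)
next
  case (step B C)
  from step.hyps(2) have "\<exists>b. b \<in> B" by (auto simp: component_dag_def)
  moreover have "\<forall>a\<in>B. \<forall>b\<in>C. rk a < rk b"
    using step.hyps(2) rk_directed by (fastforce simp: component_dag_def chain_components_eq block_def)
  ultimately show ?case using step.IH less_trans by blast
qed

lemma block_inj: "v \<in> V \<Longrightarrow> block (rk v) = block k \<longleftrightarrow> rk v = k"
  by (auto simp: block_def)

lemma mem_nondescendants_iff:
  "v \<in> nondescendants_D V E (block k) \<longleftrightarrow>
    v \<in> V \<and> rk v \<noteq> k \<and> (block k, block (rk v)) \<notin> (component_dag V E)\<^sup>+"
  by (auto simp: nondescendants_D_def chain_components_eq block_inj) (auto simp: block_def)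

lemma below_nondescendants:
  assumes "k \<in> rk ` V"
  shows "below k \<subseteq> nondescendants_D V E (block k)"
proof
  fix v assume v: "v \<in> below k"
  obtain w where w: "w \<in> V" "rk w = k" using assms by auto
  have "(block k, block (rk v)) \<notin> (component_dag V E)\<^sup>+"
    using component_dag_trancl_rank[of "block k" "block (rk v)"] v w
    by (auto simp: block_def below_def)
  then show "v \<in> nondescendants_D V E (block k)" using v by (simp add: mem_nondescendants_iff below_def)
qed

lemma nondescendants_block: 
  "v \<in> nondescendants_D V E (block k) \<Longrightarrow> block (rk v) \<subseteq> nondescendants_D V E (block k)"
  by (auto simp: mem_nondescendants_iff) (auto simp: block_def)

lemma nondescendants_sub: "nondescendants_D V E (block k) \<subseteq> V - block k"
  by (auto simp: mem_nondescendants_iff) (auto simp: block_def)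

text \<open>A directed path from the component to the component of \<open>u\<close> would extend to
  that of \<open>v\<close>. This closure under parents is what later permits all other components to
  be summed out.\<close>

lemma nondescendants_parent:
  assumes v: "v \<in> nondescendants_D V E (block k)" and uv: "directed E u v"
  shows "u \<in> nondescendants_D V E (block k)"
proof -
  have V: "u \<in> V" "v \<in> V" using directed_in_V[OF uv] by auto
  then have D: "(block (rk u), block (rk v)) \<in> component_dag V E"
    using uv by (subst component_dag_iff) (auto simp: block_def)
  then have "rk u \<noteq> k" using v by (auto simp: mem_nondescendants_iff)
  moreover have "(block k, block (rk u)) \<notin> (component_dag V E)\<^sup>+"
    using v D by (auto simp: mem_nondescendants_iff intro: trancl_into_trancl)
  ultimately show ?thesis using V by (simp add: mem_nondescendants_iff)
qed

subsection \<open>The Markov property in terms of conditional probabilities\<close>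

lemma below_Suc: "below (Suc k) = block k \<union> below k"
  by (auto simp: below_def block_def)

lemma below_eq_UN: "below k = (\<Union>j\<in>{..<k}. block j)"
  by (auto simp: below_def block_def)

lemma below_m: "below m = V"
  using rk_less by (auto simp: below_def)

text \<open>Components outside \<open>S\<close> are summed out from the last to the first: when its
  turn comes, such a component occurs only in its own kernel, which sums to one. The third
  assumption says that kernels with index in \<open>S\<close> depend only on components in
  \<open>S\<close>, so they are constant in the summation. Coordinates of rank at least
  \<open>n\<close> stay fixed because the product over \<open>k < n\<close> does not involve
  them.\<close>

lemma integ_prod_kernels:
  assumes dep: "\<And>k. unaffected (V - (block k \<union> below k)) (h k)"
    and norm: "\<And>k x. x \<in> I \<Longrightarrow> integ (block k) (h k) x = 1"
    and S: "\<And>k. k \<in> S \<Longrightarrow> unaffected (V - (\<Union>j\<in>S. block j)) (h k)"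
    and x: "x \<in> I"
  shows "integ (V - ((\<Union>j\<in>S. block j) \<union> {v. n \<le> rk v})) (\<lambda>z. \<Prod>k<n. h k z) x =
    (\<Prod>k\<in>S \<inter> {..<n}. h k x)"
  using x
proof (induction n arbitrary: x)
  case 0
  have "V - ((\<Union>j\<in>S. block j) \<union> {v. 0 \<le> rk v}) = {}" by auto
  then show ?case using integ_empty[OF 0] by simp
next
  case (Suc n)
  let ?U = "\<Union>j\<in>S. block j"
  let ?A = "\<lambda>n. V - (?U \<union> {v. n \<le> rk v})"
  show ?case
  proof (cases "n \<in> S")
    case True
    have A: "?A (Suc n) = ?A n" using True by (auto simp: block_def le_less Suc_le_eq)
    have u: "unaffected (?A n) (h n)" by (rule unaffected_mono[OF S[OF True]]) auto
    have "integ (?A (Suc n)) (\<lambda>z. \<Prod>k<Suc n. h k z) x = integ (?A n) (\<lambda>z. h n z * (\<Prod>k<n. h k z)) x"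
      by (simp add: A mult.commute)
    also have "\<dots> = h n x * (\<Prod>k\<in>S \<inter> {..<n}. h k x)"
      unfolding integ_mult[OF u Suc.prems] Suc.IH[OF Suc.prems] ..
    also have "\<dots> = (\<Prod>k\<in>S \<inter> {..<Suc n}. h k x)"
      using True by (simp add: lessThan_Suc)
    finally show ?thesis .
  next
    case False
    have A: "?A (Suc n) = ?A n \<union> block n" "?A n \<inter> block n = {}"
      using False by (auto simp: block_def)
    have u: "unaffected (block n) (\<lambda>z. \<Prod>k<n. h k z)"
      by (intro unaffected_prod unaffected_mono[OF dep]) (auto simp: block_def below_def)
    have "integ (?A (Suc n)) (\<lambda>z. \<Prod>k<Suc n. h k z) x =
        integ (?A n) (integ (block n) (\<lambda>z. (\<Prod>k<n. h k z) * h n z)) x"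
      unfolding A(1) integ_Un[OF Suc.prems A(2)] by simp
    also have "\<dots> = integ (?A n) (\<lambda>z. \<Prod>k<n. h k z) x"
      by (intro integ_cong) (simp add: integ_mult[OF u] norm)
    also have "\<dots> = (\<Prod>k\<in>S \<inter> {..<n}. h k x)" by (rule Suc.IH[OF Suc.prems])
    finally show ?thesis using False by (simp add: lessThan_Suc)
  qed
qed

lemma marg_prod_kernels:
  assumes "\<And>k. unaffected (V - (block k \<union> below k)) (h k)"
    and "\<And>k x. x \<in> I \<Longrightarrow> integ (block k) (h k) x = 1"
    and "\<And>k. k \<in> S \<Longrightarrow> unaffected (V - (\<Union>j\<in>S. block j)) (h k)"
    and x: "x \<in> I"
  shows "marg (\<lambda>z. \<Prod>k<m. h k z) (\<Union>j\<in>S. block j) x = (\<Prod>k\<in>S \<inter> {..<m}. h k x)"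
proof -
  have "V - ((\<Union>j\<in>S. block j) \<union> {v. m \<le> rk v}) = V - (\<Union>j\<in>S. block j)"
    using rk_less by (auto simp: not_le[symmetric])
  then show ?thesis using integ_prod_kernels[of h S x m] assms by simp
qed

lemma marg_prod_kernels_below:
  assumes dep: "\<And>k. unaffected (V - (block k \<union> below k)) (h k)"
    and norm: "\<And>k x. x \<in> I \<Longrightarrow> integ (block k) (h k) x = 1"
    and x: "x \<in> I" and l: "l \<le> m"
  shows "marg (\<lambda>z. \<Prod>k<m. h k z) (below l) x = (\<Prod>k<l. h k x)"
proof -
  have "unaffected (V - (\<Union>j\<in>{..<l}. block j)) (h k)" if "k \<in> {..<l}" for k
    using that by (intro unaffected_mono[OF dep]) (auto simp: block_def below_def)
  then have "marg (\<lambda>z. \<Prod>k<m. h k z) (below l) x = (\<Prod>k\<in>{..<l} \<inter> {..<m}. h k x)"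
    unfolding below_eq_UN using dep norm x by (intro marg_prod_kernels)
  moreover have "{..<l} \<inter> {..<m} = {..<l}" using l by auto
  ultimately show ?thesis by simp
qed

section \<open>Conditional probabilities given all earlier components\<close>

definition cnd :: "(('v \<Rightarrow> nat) \<Rightarrow> real) \<Rightarrow> nat \<Rightarrow> 'v set \<Rightarrow> ('v \<Rightarrow> nat) \<Rightarrow> real" where
  "cnd p k \<sigma> x = marg p (\<sigma> \<union> below k) x / marg p (below k) x"

definition no_edges :: "'v set \<Rightarrow> 'v set \<Rightarrow> bool" where
  "no_edges \<sigma> \<rho> \<longleftrightarrow> \<sigma> \<inter> \<rho> = {} \<and> (\<forall>v\<in>\<sigma>. \<forall>w\<in>\<rho>. \<not> undirected E v w)"

text \<open>An intermediate form of the Markov property. The first clause merges the independence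
  from nondescendants with the independence from non-parents of \<sigma>; the second is the
  independence of sets without edges between them. For empty blocks both are trivial.\<close>

definition graphical :: "(('v \<Rightarrow> nat) \<Rightarrow> real) \<Rightarrow> bool" where
  "graphical p \<longleftrightarrow>
    (\<forall>k \<sigma>. \<sigma> \<subseteq> block k \<longrightarrow> unaffected (V - (\<sigma> \<union> parents E \<sigma>)) (cnd p k \<sigma>)) \<and>
    (\<forall>k \<sigma> \<rho>. \<sigma> \<subseteq> block k \<longrightarrow> \<rho> \<subseteq> block k \<longrightarrow> no_edges \<sigma> \<rho> \<longrightarrow>
       (\<forall>x\<in>I. cnd p k (\<sigma> \<union> \<rho>) x = cnd p k \<sigma> x * cnd p k \<rho> x))"

lemma unaffected_cnd: "unaffected (V - (\<sigma> \<union> below k)) (cnd p k \<sigma>)"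
proof -
  have "unaffected (V - (\<sigma> \<union> below k)) (marg p (\<sigma> \<union> below k))"
       "unaffected (V - (\<sigma> \<union> below k)) (marg p (below k))"
    by (intro marg_unaffected; blast)+
  then show ?thesis unfolding cnd_def by (rule unaffected_divide)
qed

context
  fixes p :: "('v \<Rightarrow> nat) \<Rightarrow> real"
  assumes p_pos: "\<And>i. i \<in> I \<Longrightarrow> 0 < p i"
begin

lemma marg_pos: "x \<in> I \<Longrightarrow> 0 < marg p A x"
  by (rule integ_pos) (auto intro: p_pos)

lemma cnd_empty: "x \<in> I \<Longrightarrow> cnd p k {} x = 1"
  using marg_pos[of x "below k"] by (simp add: cnd_def)

lemma marg_cnd: "x \<in> I \<Longrightarrow> marg p (\<sigma> \<union> below k) x = cnd p k \<sigma> x * marg p (below k) x"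
  using marg_pos[of x "below k"] by (simp add: cnd_def)

text \<open>The denominator lives on \<open>below k\<close> and is constant in the summation, so the
  conditional probabilities of one block form a consistent family of marginals.\<close>

lemma cnd_integ:
  assumes x: "x \<in> I" and sub: "\<rho> \<subseteq> \<sigma>" "\<sigma> \<subseteq> block k"
  shows "integ (\<sigma> - \<rho>) (cnd p k \<sigma>) x = cnd p k \<rho> x"
proof -
  have D: "\<sigma> \<union> below k - (\<rho> \<union> below k) = \<sigma> - \<rho>"
    using sub block_below[of k] by auto
  have u: "unaffected (\<sigma> - \<rho>) (marg p (below k))"
    using sub block_below[of k] by (intro marg_unaffected) auto
  have "marg p (below k) x * integ (\<sigma> - \<rho>) (cnd p k \<sigma>) x =
      integ (\<sigma> - \<rho>) (\<lambda>z. marg p (below k) z * cnd p k \<sigma> z) x"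
    using integ_mult[OF u x] by simp
  also have "\<dots> = integ (\<sigma> - \<rho>) (marg p (\<sigma> \<union> below k)) x"
    using marg_cnd by (intro integ_cong) (simp add: mult.commute)
  also have "\<dots> = marg p (\<rho> \<union> below k) x"
    using marg_marg[OF x Un_mono[OF sub(1) order_refl], of "below k" p] D by simp
  finally show ?thesis using marg_pos[OF x, of "below k"] by (simp add: cnd_def field_simps)
qed

lemma cnd_block_norm: "x \<in> I \<Longrightarrow> integ (block k) (cnd p k (block k)) x = 1"
  using cnd_integ[of x "{}" "block k" k] cnd_empty by simp

text \<open>Telescoping: passing from \<open>below l\<close> to \<open>below (Suc l)\<close>
  multiplies the marginal by one conditional probability.\<close>

lemma chain_rule:
  assumes x: "x \<in> I" and sum: "(\<Sum>i\<in>I. p i) = 1"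
  shows "p x = (\<Prod>k<m. cnd p k (block k) x)"
proof -
  have "marg p (below l) x = (\<Prod>k<l. cnd p k (block k) x)" for l
  proof (induction l)
    case 0
    have "below 0 = {}" by (simp add: below_def)
    then show ?case using sum by (simp add: integ_UNIV)
  next
    case (Suc l)
    then show ?case using marg_cnd[OF x, of "block l" l] by (simp add: below_Suc mult.commute)
  qed
  from this[of m] show ?thesis using integ_empty[OF x] by (simp add: below_m)
qed

lemma markov_IV_iff_ci:
  "markov_IV V E I p \<longleftrightarrow> (\<forall>k\<in>rk ` V.
     ci p (block k) (nondescendants_D V E (block k) - parents_D V E (block k)) (parents_D V E (block k)) \<and>
     (\<forall>\<sigma>\<subseteq>block k.
        ci p \<sigma> (block k - closed_neighbors E \<sigma>) (parents_D V E (block k)) \<and>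
        ci p \<sigma> (parents_D V E (block k) - parents E \<sigma>) (parents E \<sigma>)))"
proof -
  have "cond_indep I p (block k) (nondescendants_D V E (block k) - parents_D V E (block k)) (parents_D V E (block k)) \<longleftrightarrow>
      ci p (block k) (nondescendants_D V E (block k) - parents_D V E (block k)) (parents_D V E (block k))"
    if "k \<in> rk ` V" for k
    using nondescendants_sub[of k] parents_D_bounds[OF that] block_sub[of k] below_sub[of k] block_below[of k]
    by (intro cond_indep_iff_ci p_pos) auto
  moreover have "cond_indep I p \<sigma> (block k - closed_neighbors E \<sigma>) (parents_D V E (block k)) \<longleftrightarrow>
      ci p \<sigma> (block k - closed_neighbors E \<sigma>) (parents_D V E (block k))"
    if "k \<in> rk ` V" "\<sigma> \<subseteq> block k" for k \<sigma>
    using that(2) parents_D_bounds[OF that(1)] block_sub[of k] below_sub[of k] block_below[of k]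
    by (intro cond_indep_iff_ci p_pos) (auto simp: closed_neighbors_def)
  moreover have "cond_indep I p \<sigma> (parents_D V E (block k) - parents E \<sigma>) (parents E \<sigma>) \<longleftrightarrow>
      ci p \<sigma> (parents_D V E (block k) - parents E \<sigma>) (parents E \<sigma>)"
    if "k \<in> rk ` V" "\<sigma> \<subseteq> block k" for k \<sigma>
    using that(2) parents_below[OF that(2)] parents_D_bounds[OF that(1)] block_sub[of k] below_sub[of k] block_below[of k]
    by (intro cond_indep_iff_ci p_pos) auto
  ultimately show ?thesis
    unfolding markov_IV_def chain_components_eq by simp
qed

lemma markov_IV_imp_graphical:
  assumes M: "markov_IV V E I p"
  shows "graphical p"
proof -
  \<comment> \<open>The first independence, cut down from all nondescendants to the earlier
    vertices, replaces conditioning on \<open>below k\<close> by conditioning on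
    \<open>parents_D\<close>.\<close>
  have c1: "cnd p k \<sigma> x = marg p (\<sigma> \<union> parents_D V E (block k)) x / marg p (parents_D V E (block k)) x"
    if k: "k \<in> rk ` V" and s: "\<sigma> \<subseteq> block k" and x: "x \<in> I" for k \<sigma> x
  proof -
    let ?pa = "parents_D V E (block k)"
    note b = parents_D_bounds[OF k]
    have "ci p (block k) (nondescendants_D V E (block k) - ?pa) ?pa"
      using M k unfolding markov_IV_iff_ci by blast
    then have ci: "ci p \<sigma> (below k - ?pa) ?pa"
      using nondescendants_sub[of k] below_nondescendants[OF k] b block_below[of k] s
      by (elim ci_decompose) auto
    have "\<sigma> \<union> (below k - ?pa) \<union> ?pa = \<sigma> \<union> below k" "below k - ?pa \<union> ?pa = below k"
      using b by auto
    then have "marg p (\<sigma> \<union> below k) x * marg p ?pa x = marg p (\<sigma> \<union> ?pa) x * marg p (below k) x"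
      using ciD[OF ci x] by simp
    then show ?thesis
      using marg_pos[OF x, of ?pa] marg_pos[OF x, of "below k"] by (simp add: cnd_def field_simps)
  qed
  \<comment> \<open>The independence from the other vertices of \<open>parents_D\<close> shrinks the
    condition further to \<open>parents E \<sigma>\<close>, which bounds the coordinates on which
    \<open>cnd\<close> depends.\<close>
  have c2: "cnd p k \<sigma> x = marg p (\<sigma> \<union> parents E \<sigma>) x / marg p (parents E \<sigma>) x"
    if k: "k \<in> rk ` V" and s: "\<sigma> \<subseteq> block k" and x: "x \<in> I" for k \<sigma> x
  proof -
    let ?pa = "parents_D V E (block k)"
    note b = parents_D_bounds[OF k]
    have ci: "ci p \<sigma> (?pa - parents E \<sigma>) (parents E \<sigma>)"
      using M k s unfolding markov_IV_iff_ci by blast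
    have "parents E \<sigma> \<subseteq> ?pa" using b parents_mono[OF s order_refl] by auto
    then have "\<sigma> \<union> (?pa - parents E \<sigma>) \<union> parents E \<sigma> = \<sigma> \<union> ?pa"
        "?pa - parents E \<sigma> \<union> parents E \<sigma> = ?pa" by auto
    then have "marg p (\<sigma> \<union> ?pa) x * marg p (parents E \<sigma>) x = marg p (\<sigma> \<union> parents E \<sigma>) x * marg p ?pa x"
      using ciD[OF ci x] by simp
    then show ?thesis
      using marg_pos[OF x, of ?pa] marg_pos[OF x, of "parents E \<sigma>"]
      by (simp add: c1[OF k s x] field_simps)
  qed
  have c3: "cnd p k (\<sigma> \<union> \<rho>) x = cnd p k \<sigma> x * cnd p k \<rho> x"
    if k: "k \<in> rk ` V" and s: "\<sigma> \<subseteq> block k" "\<rho> \<subseteq> block k" "no_edges \<sigma> \<rho>" and x: "x \<in> I" for k \<sigma> \<rho> x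
  proof -
    let ?pa = "parents_D V E (block k)"
    note b = parents_D_bounds[OF k]
    have "ci p \<sigma> (block k - closed_neighbors E \<sigma>) ?pa"
      using M k s unfolding markov_IV_iff_ci by blast
    moreover have "\<rho> \<subseteq> block k - closed_neighbors E \<sigma>"
      using s by (auto simp: no_edges_def closed_neighbors_def neighbors_def undirected_def)
    ultimately have ci: "ci p \<sigma> \<rho> ?pa"
      using s b block_below[of k] by (elim ci_decompose) (auto simp: closed_neighbors_def)
    then show ?thesis
      using ciD[OF ci x] marg_pos[OF x, of ?pa] s
      by (simp add: c1[OF k _ x] field_simps)
  qed
  have triv: "\<sigma> = {}" if "k \<notin> rk ` V" "\<sigma> \<subseteq> block k" for k \<sigma>
    using that by (auto simp: block_def)
  have "unaffected (V - (\<sigma> \<union> parents E \<sigma>)) (cnd p k \<sigma>)" if s: "\<sigma> \<subseteq> block k" for k \<sigma>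
  proof (cases "k \<in> rk ` V")
    case True
    have "unaffected (V - (\<sigma> \<union> parents E \<sigma>)) (marg p (\<sigma> \<union> parents E \<sigma>))"
         "unaffected (V - (\<sigma> \<union> parents E \<sigma>)) (marg p (parents E \<sigma>))"
      by (intro marg_unaffected; blast)+
    then show ?thesis
      by (intro unaffected_cong[OF c2[OF True s]] unaffected_divide)
  next
    case False
    with s have "\<sigma> = {}" by (rule triv[rotated])
    then show ?thesis using cnd_empty by (simp add: unaffected_def)
  qed
  moreover have "cnd p k (\<sigma> \<union> \<rho>) x = cnd p k \<sigma> x * cnd p k \<rho> x"
    if s: "\<sigma> \<subseteq> block k" "\<rho> \<subseteq> block k" "no_edges \<sigma> \<rho>" and x: "x \<in> I" for k \<sigma> \<rho> x
  proof (cases "k \<in> rk ` V")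
    case True
    then show ?thesis using c3 s x by blast
  next
    case False
    then have "\<sigma> = {}" "\<rho> = {}" using s triv by blast+
    then show ?thesis using x by (simp add: cnd_empty)
  qed
  ultimately show ?thesis unfolding graphical_def by blast
qed

text \<open>Nondescendants of a component may have higher rank than the component, so marginals on
  \<open>below\<close> do not suffice for the first condition. Instead \<open>R\<close> collects the
  ranks of the nondescendants: the components indexed by \<open>R\<close> and by
  \<open>insert k R\<close> are closed under parents, and the two marginals differ by the single
  kernel \<open>h k\<close>.\<close>

lemma graphical_imp_markov_IV:
  assumes G: "graphical p" and sum: "(\<Sum>i\<in>I. p i) = 1"
  shows "markov_IV V E I p"
proof -
  have u: "unaffected (V - (\<sigma> \<union> parents E \<sigma>)) (cnd p k \<sigma>)" if "\<sigma> \<subseteq> block k" for k \<sigma>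
    using G that by (simp add: graphical_def)
  have f: "cnd p k (\<sigma> \<union> \<rho>) x = cnd p k \<sigma> x * cnd p k \<rho> x"
    if "\<sigma> \<subseteq> block k" "\<rho> \<subseteq> block k" "no_edges \<sigma> \<rho>" "x \<in> I" for k \<sigma> \<rho> x
    using G that by (simp add: graphical_def)
  show ?thesis
    unfolding markov_IV_iff_ci
  proof (intro ballI conjI allI impI)
    fix k assume k: "k \<in> rk ` V"
    let ?pa = "parents_D V E (block k)" and ?nd = "nondescendants_D V E (block k)"
    note b = parents_D_bounds[OF k] and bb = block_below[of k]
    have km: "k < m" using k rk_less by auto
    define h where "h l = cnd p l (block l)" for l
    have p_eq: "marg p A x = marg (\<lambda>z. \<Prod>l<m. h l z) A x" for A x
      using chain_rule[OF _ sum] by (intro integ_cong) (simp add: h_def)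
    define R where "R = rk ` ?nd"
    have nd: "?nd = (\<Union>j\<in>R. block j)"
      using nondescendants_block[of _ k] nondescendants_sub[of k]
      by (fastforce simp: R_def block_def)
    have kR: "k \<notin> R" using nondescendants_sub[of k] by (auto simp: R_def block_def)
    have dep: "unaffected (V - (block l \<union> below l)) (h l)" for l
      unfolding h_def by (rule unaffected_cnd)
    have norm: "integ (block l) (h l) x = 1" if "x \<in> I" for l x
      unfolding h_def using that by (rule cnd_block_norm)
    have closed: "block l \<union> parents E (block l) \<subseteq> ?nd" if "l \<in> R" for l
    proof -
      have "block l \<subseteq> ?nd" using that nondescendants_block[of _ k] by (auto simp: R_def)
      then show ?thesis
        using nondescendants_parent[of _ k] by (auto simp: parents_def)
    qed
    have uR: "unaffected (V - (\<Union>j\<in>R. block j)) (h l)" if "l \<in> R" for l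
      unfolding h_def using closed[OF that]
      by (intro unaffected_mono[OF u[OF order_refl]]) (auto simp flip: nd)
    have uk: "unaffected (V - (\<Union>j\<in>insert k R. block j)) (h l)" if "l \<in> insert k R" for l
    proof (cases "l = k")
      case True
      have "parents E (block k) \<subseteq> ?nd" using b below_nondescendants[OF k] by auto
      then show ?thesis
        unfolding h_def True using nd
        by (intro unaffected_mono[OF u[OF order_refl]]) auto
    next
      case False
      then show ?thesis using that by (intro unaffected_mono[OF uR]) auto
    qed
    have fac: "marg p (block k \<union> (?nd - ?pa) \<union> ?pa) x = h k x * marg p ?nd x" if x: "x \<in> I" for x
    proof -
      have "block k \<union> (?nd - ?pa) \<union> ?pa = (\<Union>j\<in>insert k R. block j)"
        using b below_nondescendants[OF k] nd by auto
      then have "marg p (block k \<union> (?nd - ?pa) \<union> ?pa) x = (\<Prod>l\<in>insert k R \<inter> {..<m}. h l x)"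
        unfolding p_eq using marg_prod_kernels[of h "insert k R", OF dep norm uk x] by simp
      also have "\<dots> = h k x * (\<Prod>l\<in>R \<inter> {..<m}. h l x)"
        using km kR by simp
      also have "(\<Prod>l\<in>R \<inter> {..<m}. h l x) = marg p ?nd x"
        unfolding p_eq nd using marg_prod_kernels[of h R, OF dep norm uR x] by simp
      finally show ?thesis .
    qed
    show "ci p (block k) (?nd - ?pa) ?pa"
    proof (rule ci_factorI[OF _ _ _ fac])
      show "unaffected (?nd - ?pa) (h k)"
        unfolding h_def using b nondescendants_sub[of k]
        by (intro unaffected_mono[OF u[OF order_refl]]) auto
      show "unaffected (block k) (marg p ?nd)"
        using nondescendants_sub[of k] by (intro marg_unaffected) auto
    qed (use b bb nondescendants_sub[of k] in auto)
    fix \<sigma> assume s: "\<sigma> \<subseteq> block k"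
    show "ci p \<sigma> (block k - closed_neighbors E \<sigma>) ?pa"
    proof -
      define r where "r = block k - closed_neighbors E \<sigma>"
      have r: "r \<subseteq> block k" "no_edges \<sigma> r" "\<sigma> \<inter> r = {}"
        using s by (auto simp: r_def no_edges_def closed_neighbors_def neighbors_def undirected_def)
      have ps: "parents E \<sigma> \<subseteq> ?pa" "parents E r \<subseteq> ?pa"
        using b parents_mono[OF s order_refl] parents_mono[OF r(1) order_refl] by auto
      have lo: "parents E \<sigma> \<inter> r = {}" "parents E r \<inter> \<sigma> = {}"
        using ps b bb r(1) s by blast+
      \<comment> \<open>Earlier vertices outside \<open>?pa\<close> are summed out; neither
        conditional probability depends on them, since the parents of \<sigma> and of
        \<open>r\<close> lie in \<open>?pa\<close>.\<close>
      have fac: "marg p (\<sigma> \<union> r \<union> ?pa) x = cnd p k \<sigma> x * (cnd p k r x * marg p ?pa x)"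
        if x: "x \<in> I" for x
      proof -
        have D: "\<sigma> \<union> r \<union> below k - (\<sigma> \<union> r \<union> ?pa) = below k - ?pa" using s bb r(1) by auto
        have "marg p (\<sigma> \<union> r \<union> ?pa) x = integ (below k - ?pa) (marg p (\<sigma> \<union> r \<union> below k)) x"
          using marg_marg[OF x, of "\<sigma> \<union> r \<union> ?pa" "\<sigma> \<union> r \<union> below k" p] b D by auto
        also have "\<dots> = integ (below k - ?pa) (\<lambda>z. (cnd p k \<sigma> z * cnd p k r z) * marg p (below k) z) x"
          using marg_cnd[of _ "\<sigma> \<union> r" k] f[OF s r(1,2)] by (intro integ_cong) simp
        also have "\<dots> = cnd p k \<sigma> x * cnd p k r x * integ (below k - ?pa) (marg p (below k)) x"
        proof (rule integ_mult[OF unaffected_mult x])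
          show "unaffected (below k - ?pa) (cnd p k \<sigma>)"
            using ps s bb by (intro unaffected_mono[OF u[OF s]]) auto
          show "unaffected (below k - ?pa) (cnd p k r)"
            using ps r bb by (intro unaffected_mono[OF u[OF r(1)]]) auto
        qed
        also have "integ (below k - ?pa) (marg p (below k)) x = marg p ?pa x"
          using marg_marg[OF x, of ?pa "below k" p] b by simp
        finally show ?thesis by (simp add: mult.assoc)
      qed
      show ?thesis
        unfolding r_def[symmetric]
      proof (rule ci_factorI[OF _ _ _ fac])
        show "unaffected r (cnd p k \<sigma>)"
          using ps b bb r lo by (intro unaffected_mono[OF u[OF s]]) auto
        show "unaffected \<sigma> (\<lambda>x. cnd p k r x * marg p ?pa x)"
          using s ps b bb r lo
          by (intro unaffected_mult unaffected_mono[OF u[OF r(1)]] marg_unaffected)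
            auto
      qed (use s b bb r in auto)
    qed
    show "ci p \<sigma> (?pa - parents E \<sigma>) (parents E \<sigma>)"
    proof -
      have ps: "parents E \<sigma> \<subseteq> ?pa" using b parents_mono[OF s order_refl] by auto
      have lo: "\<sigma> \<inter> parents E \<sigma> = {}" "\<sigma> \<inter> below k = {}" using ps b bb s by blast+
      have "\<sigma> \<union> (below k - parents E \<sigma>) \<union> parents E \<sigma> = \<sigma> \<union> below k" using ps b by auto
      then have fac: "marg p (\<sigma> \<union> (below k - parents E \<sigma>) \<union> parents E \<sigma>) x = cnd p k \<sigma> x * marg p (below k) x"
        if "x \<in> I" for x using marg_cnd[OF that, of \<sigma> k] by simp
      \<comment> \<open>Independence from all earlier non-parents is the convenient form, because
        there the factorisation is just the definition of \<open>cnd\<close>; decomposition then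
        restricts it to \<open>?pa\<close>.\<close>
      have "ci p \<sigma> (below k - parents E \<sigma>) (parents E \<sigma>)"
      proof (rule ci_factorI[OF _ _ _ fac])
        show "unaffected (below k - parents E \<sigma>) (cnd p k \<sigma>)"
          using s bb by (intro unaffected_mono[OF u[OF s]]) auto
        show "unaffected \<sigma> (marg p (below k))"
          using s bb by (intro marg_unaffected) auto
      qed (use b ps lo in auto)
      then show ?thesis
        using b ps lo by (elim ci_decompose) auto
    qed
  qed
qed

end

subsection \<open>Connected pieces and the coordinates of a distribution\<close>

text \<open>The connected component of \<open>v\<close> in the undirected graph induced on
  \<open>S\<close>; for \<open>v\<close> outside \<open>S\<close> it is the singleton of
  \<open>v\<close>.\<close>

definition conn :: "'v set \<Rightarrow> 'v \<Rightarrow> 'v set" where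
  "conn S v = {w. (\<lambda>a b. undirected E a b \<and> a \<in> S \<and> b \<in> S)\<^sup>*\<^sup>* v w}"

definition pieces :: "'v set \<Rightarrow> 'v set set" where
  "pieces S = conn S ` S"

lemma conn_refl: "v \<in> conn S v"
  by (simp add: conn_def)

lemma conn_sub: "v \<in> S \<Longrightarrow> conn S v \<subseteq> S"
proof -
  assume "v \<in> S"
  have "w \<in> S" if "(\<lambda>a b. undirected E a b \<and> a \<in> S \<and> b \<in> S)\<^sup>*\<^sup>* v w" for w
    using that by cases (use \<open>v \<in> S\<close> in blast)+
  then show ?thesis unfolding conn_def by blast
qed

lemma conn_eq:
  assumes "w \<in> conn S v"
  shows "conn S w = conn S v"
proof -
  let ?R = "\<lambda>a b. undirected E a b \<and> a \<in> S \<and> b \<in> S"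
  have "symp ?R" by (auto simp: symp_def undirected_def)
  then have s: "?R\<^sup>*\<^sup>* b a" if "?R\<^sup>*\<^sup>* a b" for a b
    using that symp_rtranclp[of ?R] by (simp add: symp_def)
  have vw: "?R\<^sup>*\<^sup>* v w" using assms by (simp add: conn_def)
  show ?thesis
    unfolding conn_def using vw s[OF vw] by (auto intro: rtranclp_trans)
qed

text \<open>A path in \<open>S\<close> that starts in \<open>T\<close> never leaves
  \<open>T\<close>. The sets \<open>T\<close> of interest are a single piece and one side of a union
  without crossing edges.\<close>

lemma conn_local:
  assumes "T \<subseteq> S" "\<And>a b. a \<in> T \<Longrightarrow> b \<in> S \<Longrightarrow> undirected E a b \<Longrightarrow> b \<in> T" "v \<in> T"
  shows "conn S v = conn T v"
proof
  have "(\<lambda>a b. undirected E a b \<and> a \<in> T \<and> b \<in> T)\<^sup>*\<^sup>* v w \<and> w \<in> T"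
    if "(\<lambda>a b. undirected E a b \<and> a \<in> S \<and> b \<in> S)\<^sup>*\<^sup>* v w" for w
    using that
  proof induction
    case (step y z)
    then have "z \<in> T" using assms(2) by blast
    then show ?case using step by (auto intro: rtranclp.rtrancl_into_rtrancl)
  qed (use assms in auto)
  then show "conn S v \<subseteq> conn T v" by (auto simp: conn_def)
  show "conn T v \<subseteq> conn S v"
    unfolding conn_def using assms(1)
    by (auto elim!: rtranclp_mono[THEN predicate2D, rotated])
qed

lemma Union_pieces: "\<Union>(pieces S) = S"
  using conn_sub conn_refl by (fastforce simp: pieces_def)

lemma piece_sub: "C \<in> pieces S \<Longrightarrow> C \<subseteq> S"
  using Union_pieces by blast

lemma piece_nonempty: "C \<in> pieces S \<Longrightarrow> C \<noteq> {}"
  using conn_refl by (auto simp: pieces_def)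

lemma conn_piece: "C \<in> pieces S \<Longrightarrow> v \<in> C \<Longrightarrow> conn S v = C"
  by (auto simp: pieces_def conn_eq)

lemma no_edges_pieces:
  assumes C: "C \<in> pieces S" "C' \<in> pieces S" "C \<noteq> C'"
  shows "no_edges C C'"
  unfolding no_edges_def
proof (intro conjI ballI notI)
  show "C \<inter> C' = {}" using conn_piece C by blast
  fix a b assume ab: "a \<in> C" "b \<in> C'" "undirected E a b"
  then have "b \<in> conn S a"
    using piece_sub[OF C(1)] piece_sub[OF C(2)] unfolding conn_def by blast
  then have "conn S b = conn S a" by (rule conn_eq)
  then show False using conn_piece C ab by metis
qed

lemma pieces_piece:
  assumes C: "C \<in> pieces S"
  shows "pieces C = {C}"
proof -
  have "conn C v = C" if v: "v \<in> C" for v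
  proof -
    have "b \<in> C" if "a \<in> C" "b \<in> S" "undirected E a b" for a b
    proof -
      have "b \<in> conn S a" using that piece_sub[OF C] by (auto simp: conn_def)
      then show ?thesis using conn_piece[OF C \<open>a \<in> C\<close>] by simp
    qed
    then have "conn S v = conn C v" using piece_sub[OF C] v by (intro conn_local)
    then show ?thesis using conn_piece[OF C v] by simp
  qed
  then show ?thesis using piece_nonempty[OF C] by (auto simp: pieces_def)
qed

lemma no_edges_sym: "no_edges \<sigma> \<rho> \<Longrightarrow> no_edges \<rho> \<sigma>"
  by (auto simp: no_edges_def undirected_def)

lemma pieces_Un:
  assumes n: "no_edges \<sigma> \<rho>"
  shows "pieces (\<sigma> \<union> \<rho>) = pieces \<sigma> \<union> pieces \<rho>"
proof -
  have "conn (\<sigma> \<union> \<rho>) v = conn \<sigma> v" if "v \<in> \<sigma>" for v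
    using n that by (intro conn_local) (auto simp: no_edges_def)
  moreover have "conn (\<sigma> \<union> \<rho>) v = conn \<rho> v" if "v \<in> \<rho>" for v
    using no_edges_sym[OF n] that by (intro conn_local) (auto simp: no_edges_def)
  ultimately show ?thesis by (auto simp: pieces_def image_Un)
qed

lemma pieces_empty [simp]: "pieces {} = {}"
  by (simp add: pieces_def)

lemma finite_pieces: "finite S \<Longrightarrow> finite (pieces S)"
  by (simp add: pieces_def)

section \<open>Configurations as indices of coordinates\<close>

definition ref :: "'v \<Rightarrow> nat" where
  "ref = (\<lambda>v\<in>V. 1)"

text \<open>At \<open>ref\<close> the maximum ranges over the empty set and carries no meaning;
  indices are taken from \<open>I - {ref}\<close>.\<close>

definition level :: "('v \<Rightarrow> nat) \<Rightarrow> nat" where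
  "level x = Max (rk ` {v \<in> V. x v \<noteq> 1})"

text \<open>State 1 has two readings in an index: in the component of \<open>level\<close> it marks
  a vertex that is summed out, in earlier components it is a state being conditioned on.\<close>

definition supp :: "('v \<Rightarrow> nat) \<Rightarrow> 'v set" where
  "supp x = {v \<in> block (level x). x v \<noteq> 1}"

definition keep :: "'v set \<Rightarrow> ('v \<Rightarrow> nat) \<Rightarrow> 'v \<Rightarrow> nat" where
  "keep A x = override_on ref x A"

text \<open>A configuration \<open>i \<noteq> ref\<close> indexes the probability of the event that \<open>supp i\<close> is in state
  \<open>i\<close>, given that all earlier components are in state \<open>i\<close>.\<close>

definition coord :: "(('v \<Rightarrow> nat) \<Rightarrow> real) \<Rightarrow> ('v \<Rightarrow> nat) \<Rightarrow> real" where
  "coord p i = cnd p (level i) (supp i) i"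

text \<open>Each factor is read at a canonical index, where the piece and its parents keep their
  states and everything else is reset to 1. Indices of a connected set whose coordinates the model
  forces to agree thereby share one variable.\<close>

definition monomial :: "(('v \<Rightarrow> nat) \<Rightarrow> real) \<Rightarrow> ('v \<Rightarrow> nat) \<Rightarrow> real" where
  "monomial y i = (\<Prod>C\<in>pieces (supp i). y (keep (C \<union> parents E C) i))"

text \<open>The canonical indices, which label the free coordinates; their number is the dimension
  of the model.\<close>

definition keys :: "('v \<Rightarrow> nat) set" where
  "keys = (\<Union>i\<in>I - {ref}. (\<lambda>C. keep (C \<union> parents E C) i) ` pieces (supp i))"

lemma ref_in_I: "ref \<in> I"
  unfolding ref_def by (rule ones_in_I)

lemma keep_in_I: "x \<in> I \<Longrightarrow> keep A x \<in> I"
  unfolding keep_def by (intro config_override ref_in_I)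

lemma keep_in: "v \<in> A \<Longrightarrow> keep A x v = x v"
  by (simp add: keep_def)

lemma keep_out: "v \<notin> A \<Longrightarrow> v \<in> V \<Longrightarrow> keep A x v = 1"
  by (simp add: keep_def ref_def)

lemma keep_keep: "A \<subseteq> B \<Longrightarrow> keep A (keep B x) = keep A x"
  by (auto simp: keep_def override_on_def fun_eq_iff)

lemma level_supp_keep:
  assumes x: "x \<in> I" and s: "\<sigma> \<subseteq> block k" "\<sigma> \<noteq> {}" "\<And>v. v \<in> \<sigma> \<Longrightarrow> x v \<noteq> 1" and A: "A \<subseteq> below k"
  shows "keep (\<sigma> \<union> A) x \<in> I - {ref}" "level (keep (\<sigma> \<union> A) x) = k" "supp (keep (\<sigma> \<union> A) x) = \<sigma>"
proof -
  let ?i = "keep (\<sigma> \<union> A) x"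
  obtain v where v: "v \<in> \<sigma>" using s(2) by blast
  then have vV: "v \<in> V" "rk v = k" using s(1) by (auto simp: block_def)
  have iv: "?i v \<noteq> 1" using v s(3) by (simp add: keep_in)
  then have "?i \<noteq> ref" using vV by (auto simp: ref_def)
  then show "?i \<in> I - {ref}" using keep_in_I[OF x] by simp
  have sub: "w \<in> \<sigma> \<union> A" if "w \<in> V" "?i w \<noteq> 1" for w
    using that keep_out[of w "\<sigma> \<union> A" x] by blast
  show lev: "level ?i = k"
    unfolding level_def
  proof (rule Max_eqI)
    show "finite (rk ` {v \<in> V. ?i v \<noteq> 1})" using finV by simp
    show "k \<in> rk ` {v \<in> V. ?i v \<noteq> 1}" using vV iv by auto
    show "y \<le> k" if "y \<in> rk ` {v \<in> V. ?i v \<noteq> 1}" for y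
      using that sub s(1) A by (fastforce simp: block_def below_def)
  qed
  have "w \<in> \<sigma>" if "w \<in> block k" "?i w \<noteq> 1" for w
    using that sub[of w] A block_below[of k] block_sub[of k] by blast
  then show "supp ?i = \<sigma>"
    unfolding supp_def lev using s(1,3) by (auto simp: keep_in)
qed

lemma level_supp:
  assumes "i \<in> I - {ref}"
  shows "supp i \<subseteq> block (level i)" "supp i \<noteq> {}" "\<And>v. v \<in> supp i \<Longrightarrow> i v \<noteq> 1"
    "\<And>v. v \<in> V \<Longrightarrow> i v \<noteq> 1 \<Longrightarrow> v \<in> supp i \<union> below (level i)"
proof -
  let ?S = "{v \<in> V. i v \<noteq> 1}"
  have "?S \<noteq> {}"
  proof
    assume "?S = {}"
    then have "i = ref" using assms ref_in_I by (intro config_eqI) (auto simp: ref_def)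
    then show False using assms by simp
  qed
  then have "level i \<in> rk ` ?S" unfolding level_def using finV by (intro Max_in) auto
  then show "supp i \<noteq> {}" by (auto simp: supp_def block_def)
  have "rk v \<le> level i" if "v \<in> ?S" for v
    unfolding level_def using that finV by (intro Max_ge) auto
  then show "\<And>v. v \<in> V \<Longrightarrow> i v \<noteq> 1 \<Longrightarrow> v \<in> supp i \<union> below (level i)"
    by (fastforce simp: supp_def block_def below_def)
qed (auto simp: supp_def)

lemma supp_pieces:
  assumes i: "i \<in> I - {ref}" and C: "C \<in> pieces (supp i)"
  shows "C \<subseteq> block (level i)" "keep (C \<union> parents E C) i \<in> I - {ref}"
    "level (keep (C \<union> parents E C) i) = level i" "supp (keep (C \<union> parents E C) i) = C"
proof -
  show 1: "C \<subseteq> block (level i)" using piece_sub[OF C] level_supp(1)[OF i] by blast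
  have n: "i v \<noteq> 1" if "v \<in> C" for v using that piece_sub[OF C] level_supp(3)[OF i] by blast
  have iI: "i \<in> I" using i by simp
  note L = level_supp_keep[OF iI 1 piece_nonempty[OF C] n parents_below[OF 1]]
  show "keep (C \<union> parents E C) i \<in> I - {ref}" "level (keep (C \<union> parents E C) i) = level i"
    "supp (keep (C \<union> parents E C) i) = C" using L by blast+
qed

lemma keys_sub: "keys \<subseteq> I - {ref}"
  using supp_pieces(2) by (fastforce simp: keys_def)

lemma key_in: "i \<in> I - {ref} \<Longrightarrow> C \<in> pieces (supp i) \<Longrightarrow> keep (C \<union> parents E C) i \<in> keys"
  by (auto simp: keys_def)

text \<open>A piece has only itself as a piece, and resetting twice has no further effect. Hence the
  model equation at a key is vacuous.\<close>

lemma monomial_key: "i \<in> keys \<Longrightarrow> monomial y i = y i"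
proof -
  assume "i \<in> keys"
  then obtain x C where x: "x \<in> I - {ref}" "C \<in> pieces (supp x)" and i: "i = keep (C \<union> parents E C) x"
    by (auto simp: keys_def)
  have "supp i = C" unfolding i by (rule supp_pieces(4)[OF x])
  moreover have "keep (C \<union> parents E C) i = i" unfolding i by (rule keep_keep) simp
  ultimately show ?thesis by (simp add: monomial_def pieces_piece[OF x(2)])
qed

text \<open>All factors are values at keys. This is why subtracting a monomial from a dependent
  coordinate can be undone by adding it back.\<close>

lemma monomial_cong:
  "i \<in> I - {ref} \<Longrightarrow> (\<And>j. j \<in> keys \<Longrightarrow> y j = y' j) \<Longrightarrow> monomial y i = monomial y' i"
  unfolding monomial_def by (intro prod.cong refl) (use key_in in blast)

section \<open>The model as a system of monomial equations\<close>

context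
  fixes p :: "('v \<Rightarrow> nat) \<Rightarrow> real"
  assumes p_pos: "\<And>i. i \<in> I \<Longrightarrow> 0 < p i"
begin

lemma cnd_pieces:
  assumes G: "graphical p" and s: "\<sigma> \<subseteq> block k" and x: "x \<in> I"
  shows "cnd p k \<sigma> x = (\<Prod>C\<in>pieces \<sigma>. cnd p k C x)"
proof -
  have "finite \<sigma>" using s finite_block finite_subset by blast
  then have fin: "finite (pieces \<sigma>)" by (rule finite_pieces)
  have "cnd p k (\<Union>\<C>) x = (\<Prod>C\<in>\<C>. cnd p k C x)" if "\<C> \<subseteq> pieces \<sigma>" for \<C>
    using finite_subset[OF that fin] that
  proof (induction \<C> rule: finite_induct)
    case empty
    then show ?case using cnd_empty[of p, OF p_pos x] by simp
  next
    case (insert C \<C>)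
    have "C \<in> pieces \<sigma>" using insert.prems by simp
    have "no_edges C C'" if "C' \<in> \<C>" for C'
      using insert that by (intro no_edges_pieces[of C \<sigma>]) auto
    then have n: "no_edges C (\<Union>\<C>)" by (auto simp: no_edges_def)
    have "C \<subseteq> block k" "\<Union>\<C> \<subseteq> block k" using piece_sub insert.prems s by blast+
    then have "cnd p k (C \<union> \<Union>\<C>) x = cnd p k C x * cnd p k (\<Union>\<C>) x"
      using G n x unfolding graphical_def by blast
    then show ?case using insert by simp
  qed
  from this[OF order_refl] show ?thesis by (simp add: Union_pieces)
qed

lemma graphical_imp_coord_monomial:
  assumes G: "graphical p" and i: "i \<in> I - {ref}"
  shows "coord p i = monomial (coord p) i"
proof -
  have "coord p i = (\<Prod>C\<in>pieces (supp i). cnd p (level i) C i)"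
    unfolding coord_def using level_supp(1)[OF i] i by (intro cnd_pieces[OF G]) auto
  also have "\<dots> = monomial (coord p) i"
    unfolding monomial_def
  proof (rule prod.cong[OF refl])
    fix C assume C: "C \<in> pieces (supp i)"
    note L = supp_pieces[OF i C]
    have u: "unaffected (V - (C \<union> parents E C)) (cnd p (level i) C)"
      using G L(1) by (simp add: graphical_def)
    show "cnd p (level i) C i = coord p (keep (C \<union> parents E C) i)"
      unfolding coord_def L(3,4) using i L(2)
      by (intro unaffectedD[OF u]) (auto simp: keep_in)
  qed
  finally show ?thesis .
qed

text \<open>On the right \<open>v\<close> is either absent or in a state other than 1, so fewer
  vertices of the set are in state 1; their number is the measure of the inductions that
  follow.\<close>

lemma cnd_recursion:
  assumes x: "x \<in> I" and s: "\<sigma> \<subseteq> block k" and v: "v \<in> \<sigma>" "x v = 1"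
  shows "cnd p k \<sigma> x = cnd p k (\<sigma> - {v}) x - (\<Sum>j\<in>{2..d v}. cnd p k \<sigma> (x(v := j)))"
proof -
  have vV: "v \<in> V" using v(1) s block_sub by blast
  have D: "\<sigma> - (\<sigma> - {v}) = {v}" using v by auto
  have "cnd p k (\<sigma> - {v}) x = integ {v} (cnd p k \<sigma>) x"
    by (subst cnd_integ[of p, OF p_pos x Diff_subset s, symmetric]) (simp_all add: D)
  also have "\<dots> = cnd p k \<sigma> x + (\<Sum>j\<in>{2..d v}. cnd p k \<sigma> (x(v := j)))"
    by (rule integ_vertex_split[OF x vV v(2)])
  finally show ?thesis by simp
qed

lemma coord_monomial_imp_graphical:
  assumes M: "\<And>i. i \<in> I - {ref} \<Longrightarrow> coord p i = monomial (coord p) i"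
  shows "graphical p"
proof -
  \<comment> \<open>If no vertex of \<sigma> is in state 1, then a nonempty \<sigma> is the support
    of an index that keeps all of \<open>below k\<close>, and the model equation applies to that
    index.\<close>
  have base: "cnd p k \<sigma> x = (\<Prod>C\<in>pieces \<sigma>. coord p (keep (C \<union> parents E C) x))"
    if s: "\<sigma> \<subseteq> block k" and x: "x \<in> I" and n: "\<And>v. v \<in> \<sigma> \<Longrightarrow> x v \<noteq> 1" for k \<sigma> x
  proof (cases "\<sigma> = {}")
    case True
    then show ?thesis using cnd_empty[of p, OF p_pos x] by simp
  next
    case False
    let ?i = "keep (\<sigma> \<union> below k) x"
    note L = level_supp_keep[OF x s False n order_refl]
    have "cnd p k \<sigma> x = cnd p k \<sigma> ?i"
      using L(1) by (intro unaffectedD[OF unaffected_cnd x]) (auto simp: keep_in)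
    also have "\<dots> = coord p ?i" using L by (simp add: coord_def)
    also have "\<dots> = monomial (coord p) ?i" by (rule M[OF L(1)])
    also have "\<dots> = (\<Prod>C\<in>pieces \<sigma>. coord p (keep (C \<union> parents E C) ?i))"
      unfolding monomial_def using L by simp
    also have "\<dots> = (\<Prod>C\<in>pieces \<sigma>. coord p (keep (C \<union> parents E C) x))"
    proof (rule prod.cong[OF refl])
      fix C assume "C \<in> pieces \<sigma>"
      then have "C \<subseteq> \<sigma>" by (rule piece_sub)
      then have "C \<union> parents E C \<subseteq> \<sigma> \<union> below k" using parents_below[of C k] s by blast
      then show "coord p (keep (C \<union> parents E C) ?i) = coord p (keep (C \<union> parents E C) x)"
        by (simp add: keep_keep)
    qed
    finally show ?thesis .
  qed
  have upd: "{u \<in> \<sigma>. (x(v := j)) u = 1} = {u \<in> \<sigma>. x u = 1} - {v}" if "j \<in> {2..d v}"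
    for \<sigma> :: "'v set" and x :: "'v \<Rightarrow> nat" and v j using that by auto
  have dep: "cnd p k \<sigma> x = cnd p k \<sigma> x'"
    if "\<sigma> \<subseteq> block k" "x \<in> I" "x' \<in> I" "\<And>v. v \<in> \<sigma> \<union> parents E \<sigma> \<Longrightarrow> x v = x' v" for k \<sigma> x x'
    using that
  proof (induction "card {u \<in> \<sigma>. x u = 1}" arbitrary: \<sigma> x x' rule: less_induct)
    case less
    note s = less.prems(1) and x = less.prems(2) and x' = less.prems(3) and eq = less.prems(4)
    have fin: "finite \<sigma>" using s finite_block finite_subset by blast
    show ?case
    proof (cases "\<exists>v\<in>\<sigma>. x v = 1")
      case True
      then obtain v where v: "v \<in> \<sigma>" "x v = 1" by blast
      have v': "x' v = 1" using eq[of v] v by simp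
      have vV: "v \<in> V" using v s block_sub by blast
      have less_card: "card ({u \<in> \<sigma>. x u = 1} - {v}) < card {u \<in> \<sigma>. x u = 1}"
        using fin v by (intro card_Diff1_less) auto
      have "{u \<in> \<sigma> - {v}. x u = 1} = {u \<in> \<sigma>. x u = 1} - {v}" by auto
      then have 1: "cnd p k (\<sigma> - {v}) x = cnd p k (\<sigma> - {v}) x'"
        using s x x' eq parents_mono[OF _ s, of "\<sigma> - {v}"] less_card by (intro less.hyps) auto
      have 2: "cnd p k \<sigma> (x(v := j)) = cnd p k \<sigma> (x'(v := j))" if j: "j \<in> {2..d v}" for j
      proof (rule less.hyps)
        show "card {u \<in> \<sigma>. (x(v := j)) u = 1} < card {u \<in> \<sigma>. x u = 1}"
          unfolding upd[OF j] by (rule less_card)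
        show "x(v := j) \<in> I" "x'(v := j) \<in> I" using x x' vV j by (auto intro!: config_update)
        show "(x(v := j)) u = (x'(v := j)) u" if "u \<in> \<sigma> \<union> parents E \<sigma>" for u
          using eq[OF that] by simp
      qed (rule s)
      show ?thesis
        unfolding cnd_recursion[OF x s v] cnd_recursion[OF x' s v(1) v'] using 1 2 by simp
    next
      case False
      have "x' v \<noteq> 1" if "v \<in> \<sigma>" for v using False eq[of v] that by auto
      moreover have "keep (C \<union> parents E C) x = keep (C \<union> parents E C) x'" if "C \<in> pieces \<sigma>" for C
        using eq piece_sub[OF that] parents_mono[OF piece_sub[OF that] s]
        by (auto simp: keep_def override_on_def fun_eq_iff subset_iff)
      ultimately show ?thesis using base[OF s x] base[OF s x'] False by simp
    qed
  qed
  \<comment> \<open>A vertex in state 1 belongs to just one of the two sets; the conditional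
    probability of the other set ignores it and comes out of the recursion as a common
    factor.\<close>
  have fac: "cnd p k (\<sigma> \<union> \<rho>) x = cnd p k \<sigma> x * cnd p k \<rho> x"
    if "\<sigma> \<subseteq> block k" "\<rho> \<subseteq> block k" "no_edges \<sigma> \<rho>" "x \<in> I" for k \<sigma> \<rho> x
    using that
  proof (induction "card {u \<in> \<sigma> \<union> \<rho>. x u = 1}" arbitrary: \<sigma> \<rho> x rule: less_induct)
    case less
    \<comment> \<open>The primed sets stand for the pair in either order, so that the vertex in
      state 1 may be assumed to lie in the first.\<close>
    have step: "cnd p k (\<sigma>' \<union> \<rho>') x = cnd p k \<sigma>' x * cnd p k \<rho>' x"
      if s: "\<sigma>' \<subseteq> block k" "\<rho>' \<subseteq> block k" "no_edges \<sigma>' \<rho>'" and eq: "\<sigma>' \<union> \<rho>' = \<sigma> \<union> \<rho>"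
        and v: "v \<in> \<sigma>'" "x v = 1" for \<sigma>' \<rho>' v
    proof -
      have x: "x \<in> I" by (rule less.prems)
      have vV: "v \<in> V" using v s block_sub by blast
      have un: "\<sigma>' \<union> \<rho>' \<subseteq> block k" using s by blast
      have fin: "finite (\<sigma>' \<union> \<rho>')" using un finite_block finite_subset by blast
      have vr: "v \<notin> \<rho>'" using s(3) v(1) by (auto simp: no_edges_def)
      have less_card: "card ({u \<in> \<sigma>' \<union> \<rho>'. x u = 1} - {v}) < card {u \<in> \<sigma> \<union> \<rho>. x u = 1}"
        unfolding eq[symmetric] using fin v by (intro card_Diff1_less) auto
      have D: "\<sigma>' \<union> \<rho>' - {v} = (\<sigma>' - {v}) \<union> \<rho>'" using vr by auto
      have "{u \<in> \<sigma>' - {v} \<union> \<rho>'. x u = 1} = {u \<in> \<sigma>' \<union> \<rho>'. x u = 1} - {v}" using vr by auto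
      then have 1: "cnd p k (\<sigma>' - {v} \<union> \<rho>') x = cnd p k (\<sigma>' - {v}) x * cnd p k \<rho>' x"
        using s less_card x by (intro less.hyps) (auto simp: no_edges_def)
      have 2: "cnd p k (\<sigma>' \<union> \<rho>') (x(v := j)) = cnd p k \<sigma>' (x(v := j)) * cnd p k \<rho>' x"
        if j: "j \<in> {2..d v}" for j
      proof -
        have xj: "x(v := j) \<in> I" using x vV j by (auto intro!: config_update)
        have "cnd p k (\<sigma>' \<union> \<rho>') (x(v := j)) = cnd p k \<sigma>' (x(v := j)) * cnd p k \<rho>' (x(v := j))"
          using s xj less_card by (intro less.hyps) (simp_all only: upd[OF j])
        also have "cnd p k \<rho>' (x(v := j)) = cnd p k \<rho>' x"
          using xj x vr v(1) s(1) block_below[of k]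
          by (intro unaffectedD[OF unaffected_cnd]) auto
        finally show ?thesis .
      qed
      have "cnd p k (\<sigma>' \<union> \<rho>') x =
          cnd p k (\<sigma>' - {v}) x * cnd p k \<rho>' x - (\<Sum>j\<in>{2..d v}. cnd p k \<sigma>' (x(v := j)) * cnd p k \<rho>' x)"
        using cnd_recursion[OF x un UnI1[OF v(1)] v(2)] D 1 2 by simp
      also have "\<dots> = cnd p k \<sigma>' x * cnd p k \<rho>' x"
        unfolding cnd_recursion[OF x s(1) v] by (simp add: left_diff_distrib sum_distrib_right)
      finally show ?thesis .
    qed
    note s = less.prems(1,2,3) and x = less.prems(4)
    consider v where "v \<in> \<sigma>" "x v = 1" | v where "v \<in> \<rho>" "x v = 1"
      | "\<And>v. v \<in> \<sigma> \<union> \<rho> \<Longrightarrow> x v \<noteq> 1" by blast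
    then show ?case
    proof cases
      case 1
      then show ?thesis using step[OF s refl] by blast
    next
      case 2
      then show ?thesis
        using step[OF s(2,1) no_edges_sym[OF s(3)], of v] by (simp add: Un_commute mult.commute)
    next
      case 3
      have "pieces \<sigma> \<inter> pieces \<rho> = {}"
        using piece_sub piece_nonempty s(3) unfolding no_edges_def by blast
      moreover have "finite (pieces \<sigma>)" "finite (pieces \<rho>)"
        using s finite_block finite_subset finite_pieces by metis+
      moreover have "\<sigma> \<union> \<rho> \<subseteq> block k" using s by blast
      ultimately show ?thesis
        using base[of "\<sigma> \<union> \<rho>" k x] base[OF s(1) x] base[OF s(2) x] 3 x
        by (simp add: pieces_Un[OF s(3)] prod.union_disjoint)
    qed
  qed
  show ?thesis
    unfolding graphical_def
  proof (intro conjI allI impI ballI)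
    show "unaffected (V - (\<sigma> \<union> parents E \<sigma>)) (cnd p k \<sigma>)" if "\<sigma> \<subseteq> block k" for k \<sigma>
      unfolding unaffected_def
    proof (intro ballI impI)
      fix x y assume "x \<in> I" "y \<in> I" and eq: "\<forall>v\<in>V - (V - (\<sigma> \<union> parents E \<sigma>)). x v = y v"
      moreover have "\<sigma> \<union> parents E \<sigma> \<subseteq> V"
        using that block_sub[of k] below_sub[of k] parents_below[OF that] by blast
      ultimately show "cnd p k \<sigma> x = cnd p k \<sigma> y" using that by (intro dep) auto
    qed
  qed (rule fac)
qed

end

subsection \<open>Recovering the distribution from its coordinates\<close>

definition block_list :: "nat \<Rightarrow> 'v list" where
  "block_list k = (SOME vs. distinct vs \<and> set vs = block k)"

lemma block_list: "distinct (block_list k)" "set (block_list k) = block k"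
proof -
  have "\<exists>vs. distinct vs \<and> set vs = block k"
    using finite_distinct_list[OF finite_block] by blast
  then have "distinct (block_list k) \<and> set (block_list k) = block k"
    unfolding block_list_def by (rule someI_ex)
  then show "distinct (block_list k)" "set (block_list k) = block k" by auto
qed

text \<open>If \<open>y\<close> holds the coordinates of a distribution, this is the conditional
  probability of the states of those vertices of the block that are not in state 1. The default 1 is
  the probability of the empty requirement, which has no coordinate: with the whole block in state
  1, the index would have a lower level or be \<open>ref\<close>.\<close>

definition start :: "(('v \<Rightarrow> nat) \<Rightarrow> real) \<Rightarrow> nat \<Rightarrow> ('v \<Rightarrow> nat) \<Rightarrow> real" where
  "start y k x = (if \<forall>v\<in>block k. x v = 1 then 1 else y (keep (block k \<union> below k) x))"

definition kern :: "(('v \<Rightarrow> nat) \<Rightarrow> real) \<Rightarrow> nat \<Rightarrow> ('v \<Rightarrow> nat) \<Rightarrow> real" where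
  "kern y k = vdiffs (block_list k) (start y k)"

definition dens :: "(('v \<Rightarrow> nat) \<Rightarrow> real) \<Rightarrow> ('v \<Rightarrow> nat) \<Rightarrow> real" where
  "dens y x = (\<Prod>k<m. kern y k x)"

lemma keep_nonones:
  "keep (block k \<union> below k) x = keep ({v \<in> block k. x v \<noteq> 1} \<union> below k) x"
  using block_sub by (auto simp: keep_def override_on_def ref_def fun_eq_iff)

lemma keep_block_index:
  assumes "x \<in> I" "\<not> (\<forall>v\<in>block k. x v = 1)"
  shows "keep (block k \<union> below k) x \<in> I - {ref}" "level (keep (block k \<union> below k) x) = k"
    "supp (keep (block k \<union> below k) x) = {v \<in> block k. x v \<noteq> 1}"
  unfolding keep_nonones using assms
  by (intro level_supp_keep[OF assms(1), of "{v \<in> block k. x v \<noteq> 1}" k "below k"]; auto)+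

lemma unaffected_start: "unaffected (V - (block k \<union> below k)) (start y k)"
  unfolding unaffected_def
proof (intro ballI impI)
  fix x x' :: "'v \<Rightarrow> nat" assume "\<forall>v\<in>V - (V - (block k \<union> below k)). x v = x' v"
  then have eq: "x v = x' v" if "v \<in> block k \<union> below k" for v
    using that block_sub[of k] below_sub[of k] by blast
  then have "keep (block k \<union> below k) x = keep (block k \<union> below k) x'"
    by (auto simp: keep_def override_on_def)
  then show "start y k x = start y k x'" using eq by (simp add: start_def)
qed

lemma unaffected_kern: "unaffected (V - (block k \<union> below k)) (kern y k)"
  unfolding kern_def using block_sub[of k]
  by (intro unaffected_vdiffs unaffected_start) (auto simp: block_list)

text \<open>Evaluated at \<open>x\<close>, the composite of \<open>vdiffs\<close> and
  \<open>vsums\<close> is on the one hand the identity, on the other the sum over the vertices in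
  state 1.\<close>

lemma integ_kern:
  assumes x: "x \<in> I"
  shows "integ {v \<in> block k. x v = 1} (kern y k) x = start y k x"
  using vsums_eq_integ[OF x, of "block_list k" "kern y k"]
    vsums_vdiffs[OF x, of "block_list k" "start y k"] block_sub[of k]
  by (simp add: block_list kern_def)

text \<open>Normalisation comes from the default value in \<open>start\<close> and holds for
  arbitrary real \<open>y\<close>.\<close>

lemma integ_kern_block:
  assumes x: "x \<in> I"
  shows "integ (block k) (kern y k) x = 1"
proof -
  \<comment> \<open>The sum ignores the block coordinates of \<open>x\<close>, so they may be set to
    1, where \<open>integ_kern\<close> sums over the whole block.\<close>
  let ?x = "override_on x ref (block k)"
  have x': "?x \<in> I" using x ref_in_I by (rule config_override)
  have one: "?x v = 1" if "v \<in> block k" for v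
    using that block_sub[of k] by (auto simp: ref_def)
  have "integ (block k) (kern y k) x = integ (block k) (kern y k) ?x"
    using x x' by (intro unaffectedD[OF unaffected_integ]) auto
  also have "\<dots> = integ {v \<in> block k. ?x v = 1} (kern y k) ?x"
    using one by (intro arg_cong[of _ _ "\<lambda>A. integ A (kern y k) ?x"]) auto
  also have "\<dots> = 1"
    unfolding integ_kern[OF x'] start_def using one by simp
  finally show ?thesis .
qed

lemma kern_cong:
  assumes "\<And>i. i \<in> I - {ref} \<Longrightarrow> y i = y' i" "x \<in> I"
  shows "kern y k x = kern y' k x"
  unfolding kern_def using assms(2) block_sub[of k]
  by (intro vdiffs_cong) (auto simp: block_list start_def intro!: assms(1) keep_block_index)

lemma dens_cong:
  "(\<And>i. i \<in> I - {ref} \<Longrightarrow> y i = y' i) \<Longrightarrow> x \<in> I \<Longrightarrow> dens y x = dens y' x"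
  unfolding dens_def by (intro prod.cong refl kern_cong)

lemma marg_dens_below: "x \<in> I \<Longrightarrow> l \<le> m \<Longrightarrow> marg (dens y) (below l) x = (\<Prod>k<l. kern y k x)"
  using marg_prod_kernels_below[of "kern y" x l, OF unaffected_kern integ_kern_block]
  by (simp add: dens_def[abs_def])

lemma sum_dens: "(\<Sum>x\<in>I. dens y x) = 1"
  using marg_dens_below[OF ref_in_I, of 0 y] by (simp add: below_def integ_UNIV)

lemma elementary_dens:
  assumes "\<And>i. i \<in> I - {ref} \<Longrightarrow> elementary U J (\<lambda>z. Y z i)" and x: "x \<in> I"
  shows "elementary U J (\<lambda>z. dens (Y z) x)"
proof -
  have "elementary U J (\<lambda>z. start (Y z) k x)" if "x \<in> I" for k x
  proof (cases "\<forall>v\<in>block k. x v = 1")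
    case True
    then show ?thesis using elementary.const by (simp add: start_def)
  next
    case False
    then show ?thesis
      unfolding start_def if_not_P[OF False] using that by (intro assms(1) keep_block_index)
  qed
  then show ?thesis
    unfolding dens_def kern_def using x block_sub
    by (intro elementary_prod elementary_vdiffs) (auto simp: block_list)
qed

context
  fixes p :: "('v \<Rightarrow> nat) \<Rightarrow> real"
  assumes p_pos: "\<And>i. i \<in> I \<Longrightarrow> 0 < p i"
begin

lemma kern_coord:
  assumes x: "x \<in> I"
  shows "kern (coord p) k x = cnd p k (block k) x"
proof -
  have "start (coord p) k x = vsums (block_list k) (cnd p k (block k)) x" if x: "x \<in> I" for x
  proof -
    let ?s = "{v \<in> block k. x v \<noteq> 1}"
    have s: "?s \<subseteq> block k" by auto
    have "block k - ?s = {v \<in> block k. x v = 1}" by auto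
    then have "vsums (block_list k) (cnd p k (block k)) x = cnd p k ?s x"
      using vsums_eq_integ[OF x, of "block_list k"] block_sub[of k] block_list[of k]
        cnd_integ[of p, OF p_pos x s order_refl] by simp
    also have "\<dots> = start (coord p) k x"
    proof (cases "\<forall>v\<in>block k. x v = 1")
      case True
      then have "?s = {}" by auto
      then show ?thesis unfolding \<open>?s = {}\<close> start_def if_P[OF True]
        by (intro cnd_empty p_pos x)
    next
      case False
      note L = keep_block_index[OF x False]
      have "cnd p k ?s x = cnd p k ?s (keep (block k \<union> below k) x)"
        using x L(1) by (intro unaffectedD[OF unaffected_cnd]) (auto simp: keep_in)
      then show ?thesis unfolding start_def if_not_P[OF False] coord_def L(2,3) .
    qed
    finally show ?thesis by simp
  qed
  then have "kern (coord p) k x = vdiffs (block_list k) (vsums (block_list k) (cnd p k (block k))) x"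
    unfolding kern_def using x block_sub[of k] by (intro vdiffs_cong) (auto simp: block_list)
  then show ?thesis using x block_sub[of k] by (simp add: vdiffs_vsums block_list)
qed

lemma dens_coord:
  assumes "x \<in> I" "(\<Sum>i\<in>I. p i) = 1"
  shows "dens (coord p) x = p x"
  unfolding dens_def using chain_rule[of p, OF p_pos assms] by (simp add: kern_coord[OF assms(1)])

text \<open>Partial products of kernels are the marginals on the sets \<open>below l\<close>, so
  quotients of consecutive ones return the kernels; summing a kernel over the vertices of the top
  component in state 1 returns \<open>start\<close>, which is the value of \<open>y\<close> at
  \<open>i\<close>.\<close>

lemma coord_dens:
  assumes p: "\<And>x. x \<in> I \<Longrightarrow> p x = dens y x" and i: "i \<in> I - {ref}"
  shows "coord p i = y i"
proof -
  let ?k = "level i"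
  have iI: "i \<in> I" using i by simp
  note L = level_supp[OF i]
  obtain v where "v \<in> supp i" using L(2) by blast
  then have v: "v \<in> block ?k" "i v \<noteq> 1" using L by auto
  then have k: "?k < m" using rk_less[of v] by (auto simp: block_def)
  have marg: "marg p (below l) x = (\<Prod>k<l. kern y k x)" if "x \<in> I" "l \<le> m" for l x
    using marg_dens_below[OF that, of y] integ_cong[of p "dens y"] p by simp
  have "cnd p ?k (block ?k) x = kern y ?k x" if x: "x \<in> I" for x
    using marg_pos[of p, OF p_pos x, of "below ?k"] marg[OF x, of "Suc ?k"] marg[OF x, of ?k] k
    by (simp add: cnd_def below_Suc less_le del: prod_zero_iff)
  then have "integ (block ?k - supp i) (cnd p ?k (block ?k)) i = integ (block ?k - supp i) (kern y ?k) i"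
    by (intro integ_cong)
  also have "\<dots> = integ {v \<in> block ?k. i v = 1} (kern y ?k) i"
    by (intro arg_cong[of _ _ "\<lambda>A. integ A (kern y ?k) i"]) (auto simp: supp_def)
  also have "integ {v \<in> block ?k. i v = 1} (kern y ?k) i = start y ?k i" by (rule integ_kern[OF iI])
  also have "\<dots> = y (keep (block ?k \<union> below ?k) i)" using v by (auto simp: start_def)
  \<comment> \<open>Vertices of later components are in state 1 by the maximality in
    \<open>level\<close>, so the reset changes nothing.\<close>
  also have "keep (block ?k \<union> below ?k) i = i"
  proof (rule config_eqI[OF keep_in_I[OF iI] iI])
    show "keep (block ?k \<union> below ?k) i u = i u" if u: "u \<in> V" for u
    proof (cases "u \<in> block ?k \<union> below ?k")
      case False
      then have "i u = 1" using L(1) L(4)[OF u] by blast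
      then show ?thesis using keep_out[OF False u] by simp
    qed (simp add: keep_in)
  qed
  finally show ?thesis
    unfolding coord_def using cnd_integ[of p, OF p_pos iI L(1) order_refl] by simp
qed

end

subsection \<open>The global slice chart\<close>

abbreviation J where "J \<equiv> I - {ref}"
abbreviation fam where "fam \<equiv> exp_family I J (\<lambda>j x. of_bool (x = j))"

text \<open>Undoes the subtraction made in \<open>chart\<close>. It leaves the keys alone, so
  monomials have the same value before and after.\<close>

definition fill :: "(('v \<Rightarrow> nat) \<Rightarrow> real) \<Rightarrow> ('v \<Rightarrow> nat) \<Rightarrow> real" where
  "fill y i = (if i \<in> keys then y i else y i + monomial y i)"

definition chart :: "(('v \<Rightarrow> nat) \<Rightarrow> real) \<Rightarrow> ('v \<Rightarrow> nat) \<Rightarrow> real" where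
  "chart \<theta> = (\<lambda>i\<in>J. if i \<in> keys then coord (fam \<theta>) i
     else coord (fam \<theta>) i - monomial (coord (fam \<theta>)) i)"

definition unchart :: "(('v \<Rightarrow> nat) \<Rightarrow> real) \<Rightarrow> ('v \<Rightarrow> nat) \<Rightarrow> real" where
  "unchart y = (\<lambda>i\<in>J. ln (dens (fill y) i / dens (fill y) ref))"

text \<open>Total mass one is automatic for \<open>dens\<close>, so positivity alone singles out the
  coordinate vectors of distributions; it is also the condition that makes the logarithms in
  \<open>unchart\<close> smooth.\<close>

definition chart_range :: "(('v \<Rightarrow> nat) \<Rightarrow> real) set" where
  "chart_range = {y \<in> J \<rightarrow>\<^sub>E UNIV. \<forall>x\<in>I. 0 < dens (fill y) x}"

section \<open>Log-odds as the explicit inverse of the exponential family\<close>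

lemma bij_fam: "bij_betw fam (J \<rightarrow>\<^sub>E UNIV) (open_simplex I)"
  by (rule bij_betw_exp_family_open_simplex) (simp_all add: ref_in_I)

lemma fam_open_simplex: "\<theta> \<in> J \<rightarrow>\<^sub>E UNIV \<Longrightarrow> fam \<theta> \<in> open_simplex I"
  using bij_fam by (auto simp: bij_betw_def)

lemma fam_pos: "\<theta> \<in> J \<rightarrow>\<^sub>E UNIV \<Longrightarrow> i \<in> I \<Longrightarrow> 0 < fam \<theta> i"
  using fam_open_simplex by (auto simp: open_simplex_def)

lemma fam_sum: "\<theta> \<in> J \<rightarrow>\<^sub>E UNIV \<Longrightarrow> (\<Sum>i\<in>I. fam \<theta> i) = 1"
  using fam_open_simplex by (auto simp: open_simplex_def)

lemma fam_eq:
  assumes "x \<in> I"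
  shows "fam \<theta> x = exp (\<Sum>j\<in>J. \<theta> j * of_bool (x = j)) / (\<Sum>y\<in>I. exp (\<Sum>j\<in>J. \<theta> j * of_bool (y = j)))"
  by (simp only: exp_family_def restrict_apply' assms)

lemma partition_function_pos: "0 < (\<Sum>y\<in>I. exp (\<Sum>j\<in>J. \<theta> j * of_bool (y = j) :: real))"
  using ref_in_I by (intro sum_pos) auto

lemma fam_log_odds:
  assumes "\<theta> \<in> J \<rightarrow>\<^sub>E UNIV"
  shows "(\<lambda>i\<in>J. ln (fam \<theta> i / fam \<theta> ref)) = \<theta>"
proof
  fix i
  show "(\<lambda>i\<in>J. ln (fam \<theta> i / fam \<theta> ref)) i = \<theta> i"
  proof (cases "i \<in> J")
    case True
    have lin: "(\<Sum>j\<in>J. \<theta> j * of_bool (x = j)) = (if x \<in> J then \<theta> x else 0)" for x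
      by (simp add: of_bool_def if_distrib cong: if_cong)
    have "fam \<theta> i / fam \<theta> ref = exp (\<theta> i)"
      using True ref_in_I partition_function_pos[of \<theta>]
      by (simp add: fam_eq lin[of i] lin[of ref] del: sum_mult_of_bool_eq)
    then show ?thesis using True by simp
  qed (use assms in \<open>auto simp: PiE_def extensional_def\<close>)
qed

lemma fam_of_log_odds:
  assumes "q \<in> open_simplex I"
  shows "fam (\<lambda>i\<in>J. ln (q i / q ref)) = q"
proof -
  obtain \<theta> where \<theta>: "\<theta> \<in> J \<rightarrow>\<^sub>E UNIV" "q = fam \<theta>"
    using bij_fam assms by (auto simp: bij_betw_def)
  then show ?thesis using fam_log_odds[OF \<theta>(1)] by simp
qed

lemma elementary_fam: "x \<in> I \<Longrightarrow> elementary U J (\<lambda>\<theta>. fam \<theta> x)"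
  unfolding fam_eq using partition_function_pos
  by (intro elementary_divide elementary_sum elementary.exp elementary.mult elementary.coord
      elementary.const) (auto simp: less_le)

section \<open>Smoothness and invertibility of the chart\<close>

lemma elementary_coord_fam:
  assumes "i \<in> I"
  shows "elementary (J \<rightarrow>\<^sub>E UNIV) J (\<lambda>\<theta>. coord (fam \<theta>) i)"
proof -
  have "0 < marg (fam \<theta>) A i" if "\<theta> \<in> J \<rightarrow>\<^sub>E UNIV" for \<theta> A
    using fam_pos[OF that] assms by (intro marg_pos)
  then show ?thesis
    unfolding coord_def cnd_def
    by (intro elementary_divide) (auto simp: integ_def less_le intro!: elementary_sum elementary_fam)
qed

lemma elementary_monomial:
  assumes "\<And>j. j \<in> J \<Longrightarrow> elementary U J' (\<lambda>z. Y z j)" "i \<in> J"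
  shows "elementary U J' (\<lambda>z. monomial (Y z) i)"
  unfolding monomial_def using key_in[OF assms(2)] keys_sub assms(1) by (intro elementary_prod) blast

lemma elementary_fill: "i \<in> J \<Longrightarrow> elementary U J (\<lambda>y. fill y i)"
  by (cases "i \<in> keys")
    (simp_all add: fill_def elementary.add elementary.coord elementary_monomial del: Diff_iff)

lemma monomial_fill: "i \<in> J \<Longrightarrow> monomial (fill y) i = monomial y i"
  by (rule monomial_cong) (simp_all add: fill_def)

lemma fill_chart: "i \<in> J \<Longrightarrow> fill (chart \<theta>) i = coord (fam \<theta>) i"
proof -
  assume i: "i \<in> J"
  have "monomial (chart \<theta>) i = monomial (coord (fam \<theta>)) i"
    using i keys_sub by (intro monomial_cong) (auto simp: chart_def)
  then show ?thesis using i by (simp add: fill_def chart_def)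
qed

lemma dens_fill_chart:
  assumes "\<theta> \<in> J \<rightarrow>\<^sub>E UNIV" "x \<in> I"
  shows "dens (fill (chart \<theta>)) x = fam \<theta> x"
  using dens_cong[OF fill_chart assms(2)] dens_coord[OF fam_pos[OF assms(1)] assms(2) fam_sum[OF assms(1)]]
  by simp

lemma fam_unchart:
  assumes "y \<in> chart_range" "x \<in> I"
  shows "fam (unchart y) x = dens (fill y) x"
proof -
  \<comment> \<open>Elements of the simplex are undefined outside \<open>I\<close>, while
    \<open>dens\<close> is given by its product formula everywhere; hence the restriction.\<close>
  let ?q = "\<lambda>x\<in>I. dens (fill y) x"
  have "?q \<in> open_simplex I"
    using assms(1) sum_dens[of "fill y"] by (auto simp: open_simplex_def chart_range_def)
  then have "fam (\<lambda>i\<in>J. ln (?q i / ?q ref)) = ?q" by (rule fam_of_log_odds)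
  also have "(\<lambda>i\<in>J. ln (?q i / ?q ref)) = unchart y"
    using ref_in_I by (auto simp: unchart_def)
  finally show ?thesis using assms(2) by simp
qed

lemma coord_unchart:
  assumes "y \<in> chart_range" "i \<in> J"
  shows "coord (fam (unchart y)) i = fill y i"
proof (rule coord_dens[OF _ fam_unchart[OF assms(1)] assms(2)])
  show "0 < fam (unchart y) i" if "i \<in> I" for i
    using that fam_pos[of "unchart y"] by (simp add: unchart_def)
qed

lemma chart_unchart:
  assumes y: "y \<in> chart_range"
  shows "chart (unchart y) = y"
proof
  fix i
  show "chart (unchart y) i = y i"
  proof (cases "i \<in> J")
    case True
    have "monomial (coord (fam (unchart y))) i = monomial y i"
      unfolding monomial_fill[OF True, of y, symmetric] using keys_sub
      by (intro monomial_cong[OF True] coord_unchart[OF y]) auto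
    then show ?thesis
      using True coord_unchart[OF y True] by (auto simp: chart_def fill_def)
  qed (use y in \<open>auto simp: chart_def chart_range_def PiE_def extensional_def\<close>)
qed

lemma unchart_chart: "\<theta> \<in> J \<rightarrow>\<^sub>E UNIV \<Longrightarrow> unchart (chart \<theta>) = \<theta>"
  using fam_log_odds[of \<theta>] ref_in_I
  by (simp add: unchart_def dens_fill_chart cong: restrict_cong)

text \<open>A finite intersection of preimages of the positive half-line; continuity is inherited
  from membership in the elementary class.\<close>

lemma openin_chart_range: "openin (powertop_real J) chart_range"
proof -
  let ?T = "powertop_real J"
  have T: "topspace ?T = J \<rightarrow>\<^sub>E UNIV" by simp
  have "openin ?T {y \<in> topspace ?T. dens (fill y) x \<in> {0<..}}" if "x \<in> I" for x
  proof (rule openin_continuous_map_preimage)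
    have "elementary (topspace ?T) J (\<lambda>y. dens (fill y) x)"
      by (intro elementary_dens elementary_fill that)
    from elementary_continuous[OF this]
    show "continuous_map ?T euclideanreal (\<lambda>y. dens (fill y) x)" by (simp only: subtopology_topspace)
  qed simp
  then have "openin ?T ((\<Inter>x\<in>I. {y \<in> topspace ?T. dens (fill y) x \<in> {0<..}}) \<inter> topspace ?T)"
    by (intro openin_INT finite_I)
  also have "(\<Inter>x\<in>I. {y \<in> topspace ?T. dens (fill y) x \<in> {0<..}}) \<inter> topspace ?T = chart_range"
    unfolding chart_range_def T by auto
  finally show ?thesis .
qed

lemma diffeomorphism_chart: "diffeomorphism J (J \<rightarrow>\<^sub>E UNIV) chart_range chart unchart"
  unfolding diffeomorphism_def
proof (intro conjI ballI)
  show "openin (powertop_real J) (J \<rightarrow>\<^sub>E UNIV)"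
    using openin_topspace[of "powertop_real J"] by simp
  show "openin (powertop_real J) chart_range" by (rule openin_chart_range)
  show "chart \<in> (J \<rightarrow>\<^sub>E UNIV) \<rightarrow> chart_range"
    using dens_fill_chart fam_pos by (auto simp: chart_range_def chart_def[of "_"] simp del: Diff_iff)
  show "unchart \<in> chart_range \<rightarrow> (J \<rightarrow>\<^sub>E UNIV)" by (auto simp: unchart_def simp del: Diff_iff)
  show "unchart (chart \<theta>) = \<theta>" if "\<theta> \<in> J \<rightarrow>\<^sub>E UNIV" for \<theta> by (rule unchart_chart[OF that])
  show "chart (unchart y) = y" if "y \<in> chart_range" for y by (rule chart_unchart[OF that])
  fix j assume j: "j \<in> J"
  then have jI: "j \<in> I" by simp
  have "elementary (J \<rightarrow>\<^sub>E UNIV) J (\<lambda>\<theta>. coord (fam \<theta>) j - monomial (coord (fam \<theta>)) j)"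
    using j by (intro elementary_diff elementary_monomial elementary_coord_fam) auto
  then have "elementary (J \<rightarrow>\<^sub>E UNIV) J (\<lambda>\<theta>. chart \<theta> j)"
    using j elementary_coord_fam[OF jI] by (cases "j \<in> keys") (simp_all add: chart_def)
  then show "smooth_on J (J \<rightarrow>\<^sub>E UNIV) (\<lambda>\<theta>. chart \<theta> j)" by (rule elementary_smooth_on)
  have "elementary chart_range J (\<lambda>y. ln (dens (fill y) j / dens (fill y) ref))"
    using jI ref_in_I
    by (intro elementary.ln elementary_divide elementary_dens elementary_fill)
      (auto simp: chart_range_def less_le)
  then have "elementary chart_range J (\<lambda>y. unchart y j)"
    using j by (simp add: unchart_def)
  then show "smooth_on J chart_range (\<lambda>y. unchart y j)" by (rule elementary_smooth_on)
qed

section \<open>The model as a coordinate slice\<close>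

lemma P_IV_iff_coord:
  assumes "\<theta> \<in> J \<rightarrow>\<^sub>E UNIV"
  shows "fam \<theta> \<in> P_IV V E d \<longleftrightarrow> (\<forall>i\<in>J. coord (fam \<theta>) i = monomial (coord (fam \<theta>)) i)"
proof
  assume "fam \<theta> \<in> P_IV V E d"
  then have "markov_IV V E I (fam \<theta>)" by (simp add: P_IV_def)
  then show "\<forall>i\<in>J. coord (fam \<theta>) i = monomial (coord (fam \<theta>)) i"
    using markov_IV_imp_graphical graphical_imp_coord_monomial fam_pos[OF assms] by blast
next
  assume "\<forall>i\<in>J. coord (fam \<theta>) i = monomial (coord (fam \<theta>)) i"
  then have "graphical (fam \<theta>)" by (intro coord_monomial_imp_graphical fam_pos[OF assms]) auto
  then have "markov_IV V E I (fam \<theta>)"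
    by (intro graphical_imp_markov_IV fam_pos[OF assms] fam_sum[OF assms])
  then show "fam \<theta> \<in> P_IV V E d" using fam_open_simplex[OF assms] by (simp add: P_IV_def)
qed

text \<open>Outside the keys the chart records the defect of the model equation, and at the keys
  that equation holds by \<open>monomial_key\<close>.\<close>

lemma chart_zero_iff:
  assumes "\<theta> \<in> J \<rightarrow>\<^sub>E UNIV"
  shows "fam \<theta> \<in> P_IV V E d \<longleftrightarrow> (\<forall>j\<in>J - keys. chart \<theta> j = 0)"
  unfolding P_IV_iff_coord[OF assms] using monomial_key[of _ "coord (fam \<theta>)"]
  by (auto simp: chart_def)

lemma embedded_submanifold_P_IV:
  "embedded_submanifold J {\<theta> \<in> J \<rightarrow>\<^sub>E UNIV. fam \<theta> \<in> P_IV V E d}"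
proof -
  let ?M = "{\<theta> \<in> J \<rightarrow>\<^sub>E UNIV. fam \<theta> \<in> P_IV V E d}"
  have D: "diffeomorphism J (J \<rightarrow>\<^sub>E UNIV) chart_range chart unchart" by (rule diffeomorphism_chart)
  have "chart ` (?M \<inter> (J \<rightarrow>\<^sub>E UNIV)) = {y \<in> chart_range. \<forall>j\<in>J - keys. y j = 0}"
  proof (intro equalityI subsetI)
    fix y assume "y \<in> chart ` (?M \<inter> (J \<rightarrow>\<^sub>E UNIV))"
    then obtain \<theta> where "\<theta> \<in> J \<rightarrow>\<^sub>E UNIV" "fam \<theta> \<in> P_IV V E d" "y = chart \<theta>" by blast
    then show "y \<in> {y \<in> chart_range. \<forall>j\<in>J - keys. y j = 0}"
      using D chart_zero_iff[of \<theta>] by (auto simp: diffeomorphism_def simp del: Diff_iff)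
  next
    fix y assume y: "y \<in> {y \<in> chart_range. \<forall>j\<in>J - keys. y j = 0}"
    then have \<theta>: "unchart y \<in> J \<rightarrow>\<^sub>E UNIV" "chart (unchart y) = y"
      using D by (auto simp: diffeomorphism_def)
    then have "fam (unchart y) \<in> P_IV V E d" using y chart_zero_iff[OF \<theta>(1)] by simp
    with \<theta> show "y \<in> chart ` (?M \<inter> (J \<rightarrow>\<^sub>E UNIV))" by (intro image_eqI[of _ _ "unchart y"]) auto
  qed
  then have "\<forall>x\<in>?M. \<exists>U W \<phi> \<psi>. x \<in> U \<and> diffeomorphism J U W \<phi> \<psi> \<and>
      \<phi> ` (?M \<inter> U) = {y \<in> W. \<forall>j\<in>J - keys. y j = 0}"
    using D by blast
  moreover have "finite J" by simp
  moreover have "?M \<subseteq> J \<rightarrow>\<^sub>E UNIV" by blast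
  ultimately show ?thesis
    unfolding embedded_submanifold_def using keys_sub by blast
qed

lemma curved_subfamily_P_IV: "curved_subfamily_of_positive V d (P_IV V E d)"
proof -
  have "P_IV V E d \<subseteq> fam ` (J \<rightarrow>\<^sub>E UNIV)"
    using bij_fam by (auto simp: bij_betw_def P_IV_def)
  moreover have "inj_on fam (J \<rightarrow>\<^sub>E UNIV)" using bij_fam by (simp add: bij_betw_def)
  ultimately show ?thesis
    using embedded_submanifold_P_IV
    unfolding curved_subfamily_of_positive_def curved_exp_family_def ref_def by simp
qed

end

theorem corollary10:
  fixes V :: "'v set" and E :: "('v \<times> 'v) set" and d :: "'v \<Rightarrow> nat"
  assumes "chain_graph V E"
    and "\<And>v. v \<in> V \<Longrightarrow> 1 \<le> d v"
  shows "curved_subfamily_of_positive V d (P_IV V E d)"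
proof (rule chain_graph_ranking[OF assms(1)])
  fix rk :: "'v \<Rightarrow> nat" and m
  assume "\<And>v w. directed E v w \<Longrightarrow> rk v < rk w"
    and "\<And>v w. v \<in> V \<Longrightarrow> w \<in> V \<Longrightarrow> rk v = rk w \<longleftrightarrow> (undirected E)\<^sup>*\<^sup>* v w"
    and "\<And>v. v \<in> V \<Longrightarrow> rk v < m"
  moreover have "finite V" "E \<subseteq> V \<times> V" using assms(1) by (auto simp: chain_graph_def)
  ultimately interpret ranked_chain_graph V d E rk m
    using assms(2) by unfold_locales
  show ?thesis by (rule curved_subfamily_P_IV)
qed

end
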